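(* Fix $m,\ell\in\mathbb{N}$. Let $\mathbb{N}=C_1\sqcup C_2$ be a partition of $\mathbb{N}$ into two disjoint sets. Then there exist $i\in\{1,2\}$ and an infinite set $B\subseteq\mathbb{N}$ such that $$(m+\ell)B\cup\{mx+\ell y:x,y\in B,\ x<y\}\subseteq C_i.$$
   Context: $\mathbb{N}=\{1,2,3,\ldots\}$. For $k\in\mathbb{N}$ and $B\subseteq\mathbb{N}$, $kB=\{kx:x\in B\}$ (dilation). *)

theory Defs
  imports Main
begin

text \<open>The paper's natural numbers start at 1.\<close>

definition pos_nats :: "nat set" where
  "pos_nats = {1..}"

definition dilate :: "nat \<Rightarrow> nat set \<Rightarrow> nat set" where
  "dilate k B = {k * x | x. x \<in> B}"

end

theory Submission
  imports Defs Complex_Main "HOL-Library.Ramsey"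
begin

text \<open>Write \<open>n = m + l\<close> and let \<open>c\<close> be the colouring, with values in the booleans. Suppose that no infinite
set \<open>B\<close> of positive integers and no colour \<open>b\<close> satisfy \<open>c (n * x) = b\<close> for \<open>x\<close> in \<open>B\<close> and
\<open>c (m * x + l * y) = b\<close> for \<open>x < y\<close> in \<open>B\<close>. For \<open>g u = c (n * u)\<close>, Ramsey's theorem for pairs then says:
every infinite set contains an infinite \<open>T\<close> on which \<open>g\<close> is constant, while \<open>g\<close> takes the opposite value at all
the weighted means \<open>(m * x + l * y) / n\<close>, \<open>x < y\<close> in \<open>T\<close>. Call this the law of \<open>g\<close>, with flip. Laws
pass to \<open>u \<mapsto> g (r * u + t)\<close>, since affine maps commute with means; two flips cancel in an equality, so that
\<open>{u. g (l * u + t) = g (n * u)}\<close> obeys the law without flip, and so do finite intersections of such sets.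

The main step is that an infinite set \<open>V\<close> that obeys the law without flip has bounded gaps
(\<open>law_syndetic\<close>). The law gives a descent: from \<open>u\<close> in \<open>V\<close> there is a point of \<open>V\<close> within
bounded distance above \<open>(l / n) ^ j * u\<close>, for each \<open>j\<close> for which this number is not too small (\<open>descent\<close>). Hence a gap of \<open>V\<close> that is long enough is
inherited by all its dilates by powers of \<open>n / l\<close>: \<open>V\<close> avoids a wedge in the variables \<open>(j, u)\<close>.
Extend the wedge to the left as far as possible; points of \<open>V\<close> then accumulate at the left edge
\<open>\<gamma>\<close> on every large scale. Now take an ideal of sets of integers that is
invariant under preimages of \<open>Suc\<close> and of \<open>u \<mapsto> l * u div n\<close>, contains all sets which avoid the edge, and is
maximal among those without \<open>V\<close>. Maximality makes a recurrent subset \<open>P\<close> of \<open>V\<close> accessible from almost every point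
of \<open>V\<close> by boundedly many moves, and forming means with suitable points of \<open>P\<close> steers \<open>u\<close>, while it
descends to the scale of a fixed contraction \<open>(l / n) ^ E * u\<close>, to within bounded distance of any prescribed
target in a long interval to the right of that contraction
(\<open>fill_interval\<close>). So \<open>V\<close> has gaps of at most a fixed length \<open>D\<close> on a long interval just to the right of the edge.
But the set of starting points of gaps longer than \<open>D\<close> obeys the law without flip too, hence has its own descent; gaps inside
the wedge would descend into that interval, a contradiction.

For the conclusion, thin out to sets \<open>Win b\<close>, on which \<open>g (n * u)\<close> and finitely many
\<open>g (l * u + t)\<close> all equal \<open>b\<close>, such that each \<open>x\<close> in \<open>Win b\<close> has only finitely many partners \<open>u\<close> in
\<open>Win b\<close> with \<open>g (m * x + l * u) = b\<close>: if the thinning never stopped, it would build the excluded set \<open>B\<close> (\<open>closing_off\<close>).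
Bounded gaps of \<open>Win False \<union> Win True\<close> make it possible to choose \<open>x\<close> and \<open>u\<close> in \<open>Win False\<close> such that
\<open>x - l * v\<close> and \<open>u + m * v\<close> are in \<open>Win True\<close> for one \<open>v\<close>. As
\<open>m * x + l * u = m * (x - l * v) + l * (u + m * v)\<close>, the value of \<open>g\<close> at this number would be both true and false,
unless \<open>u\<close> is one of the finitely many exceptions.\<close>

section \<open>Colour laws on weighted means\<close>

locale weights =
  fixes m l :: nat
  assumes m_pos: "0 < m" and l_pos: "0 < l"
begin

definition n :: nat where "n = m + l"

text \<open>The weighted mean of \<open>x\<close> and \<open>y\<close>, rounded down. It is exact when \<open>n\<close> divides
\<open>m * x + l * y\<close>.\<close>

definition mean :: "nat \<Rightarrow> nat \<Rightarrow> nat" where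
  "mean x y = (m * x + l * y) div n"

text \<open>\<open>P\<close> has the constant value \<open>b\<close> on \<open>T\<close>, all means of pairs \<open>x < y\<close> from \<open>T\<close> are
exact, and at these means \<open>P\<close> has the value \<open>b\<close>, or the opposite value if the flip \<open>s\<close> is set.\<close>

definition follows :: "(nat \<Rightarrow> bool) \<Rightarrow> bool \<Rightarrow> bool \<Rightarrow> nat set \<Rightarrow> bool" where
  "follows P s b T \<longleftrightarrow> (\<forall>x\<in>T. P x = b) \<and>
     (\<forall>x\<in>T. \<forall>y\<in>T. x < y \<longrightarrow> n dvd m * x + l * y \<and> P (mean x y) = (b \<noteq> s))"

text \<open>Every infinite set can be thinned out to an infinite one along which \<open>P\<close> behaves
as described, with flip \<open>s\<close>.\<close>

definition law :: "(nat \<Rightarrow> bool) \<Rightarrow> bool \<Rightarrow> bool" where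
  "law P s \<longleftrightarrow> (\<forall>S. infinite S \<longrightarrow> (\<exists>T b. T \<subseteq> S \<and> infinite T \<and> follows P s b T))"

lemma n_pos: "0 < n" using m_pos by (simp add: n_def)

lemma lawE:
  assumes "law P s" "infinite S"
  obtains T b where "T \<subseteq> S" "infinite T" "follows P s b T"
  using assms unfolding law_def by blast

lemma lawI:
  assumes "\<And>S. infinite S \<Longrightarrow> \<exists>T b. T \<subseteq> S \<and> infinite T \<and> follows P s b T"
  shows "law P s"
  using assms unfolding law_def by blast

lemma followsD:
  assumes "follows P s b T"
  shows "x \<in> T \<Longrightarrow> P x = b"
    and "x \<in> T \<Longrightarrow> y \<in> T \<Longrightarrow> x < y \<Longrightarrow> n dvd m * x + l * y"
    and "x \<in> T \<Longrightarrow> y \<in> T \<Longrightarrow> x < y \<Longrightarrow> P (mean x y) = (b \<noteq> s)"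
  using assms unfolding follows_def by simp_all

lemma followsI:
  assumes "\<And>x. x \<in> T \<Longrightarrow> P x = b"
    and "\<And>x y. x \<in> T \<Longrightarrow> y \<in> T \<Longrightarrow> x < y \<Longrightarrow> n dvd m * x + l * y"
    and "\<And>x y. x \<in> T \<Longrightarrow> y \<in> T \<Longrightarrow> x < y \<Longrightarrow> P (mean x y) = (b \<noteq> s)"
  shows "follows P s b T"
  using assms unfolding follows_def by simp

lemma follows_subset: "follows P s b T \<Longrightarrow> T' \<subseteq> T \<Longrightarrow> follows P s b T'"
  by (rule followsI) (simp_all add: followsD subset_eq)

text \<open>Numbers in a common residue class modulo \<open>n\<close> have exact means, because \<open>m + l = n\<close>.\<close>

lemma infinite_residue:
  assumes "infinite (S :: nat set)"
  shows "\<exists>T\<subseteq>S. infinite T \<and> (\<forall>x\<in>T. \<forall>y\<in>T. n dvd m * x + l * y)"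
proof -
  have "finite ((\<lambda>x. x mod n) ` S)"
    by (rule finite_subset[of _ "{..<n}"]) (use n_pos in auto)
  from pigeonhole_infinite[OF assms this] obtain a where a: "a \<in> S" "infinite {x\<in>S. x mod n = a mod n}" by blast
  have "n dvd m * x + l * y" if xy: "x mod n = a mod n" "y mod n = a mod n" for x y
  proof -
    have "m * x + l * y = m * (n * (x div n) + a mod n) + l * (n * (y div n) + a mod n)"
      using mult_div_mod_eq[of n x] mult_div_mod_eq[of n y] unfolding xy by simp
    also have "\<dots> = n * (m * (x div n) + l * (y div n) + a mod n)"
      by (simp add: n_def algebra_simps)
    finally show "n dvd m * x + l * y" by (rule dvdI)
  qed
  then show ?thesis using a by (intro exI[of _ "{x\<in>S. x mod n = a mod n}"]) auto
qed

lemma law_affine: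
  assumes P: "law P s" and r: "0 < r"
  shows "law (\<lambda>u. P (r * u + t)) s"
proof (rule lawI)
  fix S :: "nat set" assume "infinite S"
  from infinite_residue[OF this] obtain S1 where S1: "S1 \<subseteq> S" "infinite S1"
    "\<forall>x\<in>S1. \<forall>y\<in>S1. n dvd m * x + l * y" by blast
  define f where "f = (\<lambda>u. r * u + t)"
  have inj: "inj f" using r by (auto simp: f_def inj_def)
  have "infinite (f ` S1)" using S1(2) inj by (meson finite_imageD inj_on_subset top_greatest)
  with P obtain T b where T: "T \<subseteq> f ` S1" "infinite T" "follows P s b T" by (rule lawE)
  define T0 where "T0 = {x\<in>S1. f x \<in> T}"
  have fT: "f ` T0 = T" using T(1) by (auto simp: T0_def)
  have "infinite T0" using T(2) fT by (metis finite_imageI)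
  moreover have "P (r * mean x y + t) = (b \<noteq> s)" if "x \<in> T0" "y \<in> T0" "x < y" for x y
  proof -
    have "n dvd m * x + l * y" using S1(3) that by (simp add: T0_def)
    then obtain z where z: "m * x + l * y = n * z" by (rule dvdE)
    have mz: "mean x y = z" using z n_pos by (simp add: mean_def)
    have "m * f x + l * f y = r * (m * x + l * y) + (m + l) * t" by (simp add: f_def algebra_simps)
    also have "\<dots> = n * (r * z + t)" unfolding z by (simp add: n_def algebra_simps)
    finally have "mean (f x) (f y) = r * z + t" using n_pos by (simp add: mean_def)
    moreover have "f x < f y" using that r by (simp add: f_def)
    moreover have "f x \<in> T" "f y \<in> T" using that by (auto simp: T0_def)
    ultimately show ?thesis using followsD(3)[OF T(3), of "f x" "f y"] mz by simp
  qed
  then have "follows (\<lambda>u. P (r * u + t)) s b T0"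
    using S1(3) followsD(1)[OF T(3)] by (intro followsI) (auto simp: T0_def f_def)
  ultimately show "\<exists>T b. T \<subseteq> S \<and> infinite T \<and> follows (\<lambda>u. P (r * u + t)) s b T"
    using S1(1) by (intro exI[of _ T0] exI[of _ b]) (auto simp: T0_def)
qed

lemma law_not: 
  assumes "law P s" shows "law (\<lambda>u. \<not> P u) s"
proof (rule lawI)
  fix S :: "nat set" assume "infinite S"
  with assms obtain T b where T: "T \<subseteq> S" "infinite T" "follows P s b T" by (rule lawE)
  have "follows (\<lambda>u. \<not> P u) s (\<not> b) T"
    by (rule followsI) (simp_all add: followsD[OF T(3)])
  then show "\<exists>T b. T \<subseteq> S \<and> infinite T \<and> follows (\<lambda>u. \<not> P u) s b T" using T by blast
qed

lemma law2E:
  assumes "law P s" "law Q s'" "infinite S"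
  obtains T b b' where "T \<subseteq> S" "infinite T" "follows P s b T" "follows Q s' b' T"
proof -
  from assms(1,3) obtain T b where T: "T \<subseteq> S" "infinite T" "follows P s b T" by (rule lawE)
  from assms(2) T(2) obtain T' b' where T': "T' \<subseteq> T" "infinite T'" "follows Q s' b' T'" by (rule lawE)
  show ?thesis using that[of T' b b'] T T' follows_subset by blast
qed

text \<open>Flips add modulo 2.\<close>

lemma law_eq: 
  assumes "law P s" "law Q s'" shows "law (\<lambda>u. P u = Q u) (s \<noteq> s')"
proof (rule lawI)
  fix S :: "nat set" assume "infinite S"
  with assms obtain T b b' where T: "T \<subseteq> S" "infinite T" "follows P s b T" "follows Q s' b' T"
    by (rule law2E)
  have "follows (\<lambda>u. P u = Q u) (s \<noteq> s') (b = b') T"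
    by (rule followsI) (auto simp: followsD[OF T(3)] followsD[OF T(4)])
  then show "\<exists>T b. T \<subseteq> S \<and> infinite T \<and> follows (\<lambda>u. P u = Q u) (s \<noteq> s') b T" using T by blast
qed

lemma law_conj: 
  assumes "law P False" "law Q False" shows "law (\<lambda>u. P u \<and> Q u) False"
proof (rule lawI)
  fix S :: "nat set" assume "infinite S"
  with assms obtain T b b' where T: "T \<subseteq> S" "infinite T" "follows P False b T" "follows Q False b' T"
    by (rule law2E)
  have "follows (\<lambda>u. P u \<and> Q u) False (b \<and> b') T"
    by (rule followsI) (auto simp: followsD[OF T(3)] followsD[OF T(4)])
  then show "\<exists>T b. T \<subseteq> S \<and> infinite T \<and> follows (\<lambda>u. P u \<and> Q u) False b T" using T by blast
qed

lemma law_True: "law (\<lambda>u. True) False"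
proof (rule lawI)
  fix S :: "nat set" assume "infinite S"
  from infinite_residue[OF this] obtain T where T: "T \<subseteq> S" "infinite T"
    "\<forall>x\<in>T. \<forall>y\<in>T. n dvd m * x + l * y" by blast
  have "follows (\<lambda>u. True) False True T" using T by (intro followsI) auto
  then show "\<exists>T b. T \<subseteq> S \<and> infinite T \<and> follows (\<lambda>u. True) False b T" using T by blast
qed

lemma law_ball:
  assumes "finite I" "\<And>i. i \<in> I \<Longrightarrow> law (P i) False"
  shows "law (\<lambda>u. \<forall>i\<in>I. P i u) False"
  using assms by (induction I rule: finite_induct) (auto intro: law_True law_conj)

definition mu :: real where "mu = real l / real n"
definition lam :: real where "lam = real m / real n"

lemma mu_bounds: "0 < mu" "mu < 1" "0 < lam" "lam < 1" "lam + mu = 1"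
  using m_pos l_pos by (auto simp: mu_def lam_def n_def divide_simps)

lemma mu_power: "0 < mu ^ i" "mu ^ i \<le> 1" 
  using mu_bounds by (auto intro: power_le_one)

lemma mu_power_le: "i \<le> j \<Longrightarrow> mu ^ j \<le> mu ^ i" 
  using mu_bounds by (intro power_decreasing) auto

lemma mean_bounds: "lam * x + mu * y - 1 \<le> real (mean x y)" "real (mean x y) \<le> lam * x + mu * y"
proof -
  define N where "N = m * x + l * y"
  have e: "lam * x + mu * y = real N / real n" 
    by (simp add: lam_def mu_def N_def add_divide_distrib)
  have d: "real N = real n * real (N div n) + real (N mod n)"
    by (metis mult_div_mod_eq of_nat_add of_nat_mult)
  have "N mod n < n" using n_pos by simp
  then have r: "0 \<le> real (N mod n) / real n" "real (N mod n) / real n \<le> 1" by simp_all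
  have "real N / real n = real (N div n) + real (N mod n) / real n"
    using n_pos unfolding d by (simp add: add_divide_distrib)
  then show "lam * x + mu * y - 1 \<le> real (mean x y)" "real (mean x y) \<le> lam * x + mu * y"
    using r unfolding e mean_def N_def[symmetric] by linarith+
qed

lemma mean_eq: "n dvd m * x + l * y \<Longrightarrow> real (mean x y) = lam * x + mu * y"
  by (simp add: mean_def real_of_nat_div lam_def mu_def add_divide_distrib)

lemma means_unbounded:
  assumes "infinite T" "x \<in> T"
  shows "infinite (mean x ` {y\<in>T. x < y})"
proof (rule infinite_nat_iff_unbounded[THEN iffD2], rule allI)
  fix k
  obtain y where y: "y \<in> T" "y > max x (nat \<lceil>(real k + 2) / mu\<rceil>)" 
    using assms(1) infinite_nat_iff_unbounded by blast
  then have "real y \<ge> (real k + 2) / mu" by linarith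
  then have "mu * y \<ge> k + 2" using mu_bounds(1) by (simp add: pos_divide_le_eq mult.commute)
  moreover have "0 \<le> lam * real x" using mu_bounds(3) by simp
  ultimately have "real (mean x y) > k" using mean_bounds(1)[of x y] by linarith
  then show "\<exists>n>k. n \<in> mean x ` {y \<in> T. x < y}" using y by auto
qed

section \<open>Descent along powers of the ratio\<close>

text \<open>Every infinite subset of \<open>V\<close> contains a pair with exact mean in \<open>V\<close>. This is the only consequence of the law
that the descent needs.\<close>

definition mean_recurrent :: "nat set \<Rightarrow> bool" where
  "mean_recurrent V \<longleftrightarrow> (\<forall>S. S \<subseteq> V \<longrightarrow> infinite S \<longrightarrow> (\<exists>x\<in>S. \<exists>y\<in>S. x < y \<and> n dvd m * x + l * y \<and> mean x y \<in> V))"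

lemma law_mean_recurrent: assumes "law (\<lambda>u. u \<in> V) False" shows "mean_recurrent V"
  unfolding mean_recurrent_def
proof (intro allI impI)
  fix S assume S: "S \<subseteq> V" "infinite S"
  from assms S(2) obtain T b where T: "T \<subseteq> S" "infinite T" "follows (\<lambda>u. u \<in> V) False b T"
    by (rule lawE)
  obtain x where x: "x \<in> T" using T(2) by (metis finite.emptyI equals0I)
  obtain y where y: "y \<in> T" "x < y" using T(2) infinite_nat_iff_unbounded by blast
  have "b" using followsD(1)[OF T(3) x] T(1) S(1) x by blast
  then have "mean x y \<in> V" "n dvd m * x + l * y"
    using followsD(2,3)[OF T(3) x y] by auto
  then show "\<exists>x\<in>S. \<exists>y\<in>S. x < y \<and> n dvd m * x + l * y \<and> mean x y \<in> V"
    using T(1) x y by blast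
qed

text \<open>Otherwise there would be a rapidly growing sequence in \<open>V\<close> whose exact means all avoid \<open>V\<close>: the mean
of \<open>x < y\<close> exceeds \<open>mu * y\<close> by \<open>lam * x\<close>, which is at most the length of the window that is free of \<open>V\<close>.\<close>

lemma one_step:
  assumes "mean_recurrent V"
  obtains k :: nat where "\<And>q. q \<in> V \<Longrightarrow> q \<ge> k \<Longrightarrow> \<exists>u\<in>V. mu * q \<le> u \<and> u \<le> mu * q + k"
proof (rule ccontr)
  assume nt: "\<not> thesis"
  have "\<exists>q. q \<in> V \<and> q > a \<and> \<not> (\<exists>u\<in>V. mu * q \<le> u \<and> u \<le> mu * q + a)" for a :: nat
  proof (rule ccontr)
    assume H: "\<not> ?thesis"
    have "\<exists>u\<in>V. mu * q \<le> u \<and> u \<le> mu * q + (Suc a)" if "q \<in> V" "q \<ge> Suc a" for q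
    proof -
      have "a < q" using that by simp
      with H that(1) obtain u where "u \<in> V" "mu * q \<le> u" "u \<le> mu * q + a" by blast
      then show ?thesis by (intro bexI[of _ u]) auto
    qed
    then show False using nt that[of "Suc a"] by blast
  qed
  then have "\<exists>f :: nat \<Rightarrow> nat. \<forall>a. f a \<in> V \<and> a < f a \<and> \<not> (\<exists>u\<in>V. mu * f a \<le> u \<and> u \<le> mu * f a + a)"
    by (intro choice) blast
  then obtain f :: "nat \<Rightarrow> nat" where f: "\<And>a. f a \<in> V" "\<And>a. a < f a"
    "\<And>a u. u \<in> V \<Longrightarrow> mu * f a \<le> u \<Longrightarrow> \<not> u \<le> mu * f a + a" by blast
  define q where "q = rec_nat (f 0) (\<lambda>_. f)"
  have q: "q (Suc j) = f (q j)" for j by (simp add: q_def)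
  have qV: "q j \<in> V" for j by (cases j) (auto simp: q_def f)
  have sm: "strict_mono q" by (rule strict_mono_Suc_iff[THEN iffD2]) (auto simp: q f)
  then have "infinite (range q)" using range_inj_infinite strict_mono_imp_inj_on by blast
  moreover have "range q \<subseteq> V" using qV by blast
  ultimately have "\<exists>x\<in>range q. \<exists>y\<in>range q. x < y \<and> n dvd m * x + l * y \<and> mean x y \<in> V"
    using assms unfolding mean_recurrent_def by meson
  then obtain x y where xy: "x \<in> range q" "y \<in> range q" "x < y" "n dvd m * x + l * y" "mean x y \<in> V"
    by blast
  then obtain i j where ij: "x = q i" "y = q j" by blast
  have "i < j" using xy(3) sm ij strict_mono_less by blast
  then obtain j' where j': "j = Suc j'" "i \<le> j'" by (cases j) auto
  have "x \<le> q j'" using j' sm ij by (simp add: strict_mono_less_eq)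
  have me: "real (mean x y) = lam * x + mu * y" using mean_eq xy(4) .
  have "lam * x \<le> 1 * real x" using mu_bounds by (intro mult_right_mono) auto
  then have "lam * x \<le> q j'" using \<open>x \<le> q j'\<close> by simp
  moreover have "0 \<le> lam * x" using mu_bounds by simp
  ultimately show False using f(3)[OF xy(5), of "q j'"] me ij j' q by simp
qed

text \<open>The errors of the single steps form a geometric series.\<close>

lemma descent:
  assumes "mean_recurrent V"
  obtains k :: real where "0 \<le> k"
    "\<And>j u. u \<in> V \<Longrightarrow> k \<le> mu ^ j * real u \<Longrightarrow> \<exists>u'\<in>V. mu ^ j * u \<le> u' \<and> u' \<le> mu ^ j * u + k"
proof -
  obtain k0 :: nat where k0: "\<And>q. q \<in> V \<Longrightarrow> q \<ge> k0 \<Longrightarrow> \<exists>u\<in>V. mu * q \<le> u \<and> u \<le> mu * q + k0"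
    using one_step[OF assms] by blast
  \<comment> \<open>The fixed point of \<open>k \<mapsto> mu * k + k0\<close>.\<close>
  define k where "k = k0 / lam"
  have kk: "k0 \<le> k" using mu_bounds(3,4) by (simp add: k_def pos_le_divide_eq mult_left_le)
  have "lam * k = k0" using mu_bounds by (simp add: k_def)
  moreover have "(lam + mu) * k = k" by (simp add: mu_bounds)
  ultimately have kl: "mu * k + k0 = k" by (simp add: distrib_right)
  have "\<exists>u'\<in>V. mu ^ j * u \<le> u' \<and> u' \<le> mu ^ j * u + k" if "u \<in> V" "k \<le> mu ^ j * real u" for j u
    using that
  proof (induction j)
    case 0
    then show ?case using kk by (intro bexI[of _ u]) auto
  next
    case (Suc j)
    have "mu * (mu ^ j * u) \<le> 1 * (mu ^ j * u)" using mu_bounds by (intro mult_right_mono) auto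
    then have "k \<le> mu ^ j * u" using Suc.prems(2) by (simp add: mult.assoc)
    with Suc obtain v where v: "v \<in> V" "mu ^ j * u \<le> v" "v \<le> mu ^ j * u + k" by blast
    have "k0 \<le> v" using v(2) \<open>k \<le> mu ^ j * u\<close> kk by simp
    then obtain w where w: "w \<in> V" "mu * v \<le> w" "w \<le> mu * v + k0" using k0 v(1) by blast
    have "mu * (mu ^ j * u) \<le> mu * v" "mu * v \<le> mu * (mu ^ j * u + k)" 
      using v mu_bounds by (auto intro: mult_left_mono)
    then show ?case using w kl by (intro bexI[of _ w]) (auto simp: algebra_simps)
  qed
  moreover have "0 \<le> k" using kk by simp
  ultimately show ?thesis using that by blast
qed

section \<open>Invariant ideals and recurrent subsets\<close>

text \<open>The mean of \<open>0\<close> and \<open>u\<close>. Every mean \<open>mean x u\<close> differs from it by at most \<open>x + 1\<close>.\<close>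

definition eta :: "nat \<Rightarrow> nat" where "eta u = l * u div n"

lemma eta_bounds: "mu * u - 1 \<le> real (eta u)" "real (eta u) \<le> mu * u"
  using mean_bounds[of 0 u] by (simp_all add: eta_def mean_def)

text \<open>Ideals of sets of natural numbers that are invariant under preimages of \<open>Suc\<close> and \<open>eta\<close>. Their
members play the part of negligible sets. By invariance, preimages under \<open>mean x\<close> are negligible too
(\<open>mean_vimage\<close> below).\<close>

definition inv_ideal :: "nat set set \<Rightarrow> bool" where
  "inv_ideal J \<longleftrightarrow> {} \<in> J \<and> (\<forall>A\<in>J. \<forall>B. B \<subseteq> A \<longrightarrow> B \<in> J) \<and> (\<forall>A\<in>J. \<forall>B\<in>J. A \<union> B \<in> J) \<and>
     (\<forall>A\<in>J. Suc -` A \<in> J) \<and> (\<forall>A\<in>J. eta -` A \<in> J)"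

lemma inv_idealD:
  assumes "inv_ideal J"
  shows "{} \<in> J" "A \<in> J \<Longrightarrow> B \<subseteq> A \<Longrightarrow> B \<in> J" "A \<in> J \<Longrightarrow> B \<in> J \<Longrightarrow> A \<union> B \<in> J"
    "A \<in> J \<Longrightarrow> Suc -` A \<in> J" "A \<in> J \<Longrightarrow> eta -` A \<in> J"
  using assms unfolding inv_ideal_def by simp_all

lemma inv_ideal_UN:
  assumes "inv_ideal J" "finite I" "\<And>i. i \<in> I \<Longrightarrow> X i \<in> J"
  shows "(\<Union>i\<in>I. X i) \<in> J"
  using assms(2,3) by (induction I rule: finite_induct) (auto intro: inv_idealD(1,3)[OF assms(1)])

lemma maximal_inv_ideal:
  assumes "inv_ideal J0" "V \<notin> J0"
  obtains J where "inv_ideal J" "J0 \<subseteq> J" "V \<notin> J"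
    "\<forall>J'. inv_ideal J' \<longrightarrow> J \<subseteq> J' \<longrightarrow> V \<notin> J' \<longrightarrow> J' = J"
proof -
  define A where "A = {J. inv_ideal J \<and> J0 \<subseteq> J \<and> V \<notin> J}"
  have "\<exists>M\<in>A. \<forall>X\<in>A. M \<subseteq> X \<longrightarrow> X = M"
  proof (rule subset_Zorn_nonempty)
    show "A \<noteq> {}" using assms by (auto simp: A_def)
    fix C assume C: "C \<noteq> {}" "subset.chain A C"
    have CA: "J \<in> C \<Longrightarrow> inv_ideal J \<and> J0 \<subseteq> J \<and> V \<notin> J" for J
      using C(2) unfolding subset.chain_def A_def by blast
    obtain J1 where J1: "J1 \<in> C" using C(1) by blast
    have un: "A \<union> B \<in> \<Union>C" if AB: "A \<in> \<Union>C" "B \<in> \<Union>C" for A B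
    proof -
      obtain J K where JK: "J \<in> C" "A \<in> J" "K \<in> C" "B \<in> K" using AB by blast
      then have "J \<subseteq> K \<or> K \<subseteq> J" using C(2) unfolding subset.chain_def by blast
      then show ?thesis using JK inv_idealD(3) CA by blast
    qed
    have "inv_ideal (\<Union>C)"
      unfolding inv_ideal_def
    proof (intro conjI ballI allI impI)
      show "{} \<in> \<Union>C" using J1 CA inv_idealD(1) by blast
      fix A assume "A \<in> \<Union>C"
      then obtain J where J: "J \<in> C" "A \<in> J" by blast
      show "Suc -` A \<in> \<Union>C" "eta -` A \<in> \<Union>C" using J CA inv_idealD(4,5) by blast+
      show "B \<in> \<Union>C" if "B \<subseteq> A" for B using that J CA inv_idealD(2) by blast
      show "A \<union> B \<in> \<Union>C" if "B \<in> \<Union>C" for B using un \<open>A \<in> \<Union>C\<close> that by blast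
    qed
    moreover have "J0 \<subseteq> \<Union>C" using J1 CA by blast
    moreover have "V \<notin> \<Union>C" using CA by blast
    ultimately show "\<Union>C \<in> A" by (simp add: A_def)
  qed
  then obtain M where M: "M \<in> A" "\<forall>X\<in>A. M \<subseteq> X \<longrightarrow> X = M" by blast
  show ?thesis
  proof (rule that[of M], goal_cases)
    case 4
    show ?case
    proof (intro allI impI)
      fix J' assume "inv_ideal J'" "M \<subseteq> J'" "V \<notin> J'"
      moreover have "J0 \<subseteq> M" using M(1) by (simp add: A_def)
      ultimately have "J' \<in> A" by (auto simp: A_def)
      then show "J' = M" using M(2) \<open>M \<subseteq> J'\<close> by blast
    qed
  qed (use M(1) in \<open>auto simp: A_def\<close>)
qed

text \<open>The monoid generated by the two maps under which the ideals are invariant. Up to a bounded error,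
each member multiplies by a power of \<open>mu\<close>.\<close>

inductive_set moves :: "(nat \<Rightarrow> nat) set" where
  id: "id \<in> moves"
| Suc: "a \<in> moves \<Longrightarrow> a \<circ> Suc \<in> moves"
| eta: "a \<in> moves \<Longrightarrow> a \<circ> eta \<in> moves"

lemma moves_approx:
  assumes "a \<in> moves"
  shows "\<exists>k C. \<forall>u. \<bar>real (a u) - mu ^ k * real u\<bar> \<le> C"
  using assms
proof induction
  case id
  then show ?case by (intro exI[of _ 0]) auto
next
  case (Suc a)
  then obtain k C where C: "\<And>u. \<bar>real (a u) - mu ^ k * real u\<bar> \<le> C" by blast
  have "0 \<le> mu ^ k" "mu ^ k \<le> 1" using mu_bounds by (auto intro: power_le_one)
  then have "\<bar>real ((a \<circ> Suc) u) - mu ^ k * real u\<bar> \<le> C + 1" for u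
    using C[of "Suc u"] by (simp add: algebra_simps abs_le_iff)
  then show ?case by blast
next
  case (eta a)
  then obtain k C where C: "\<And>u. \<bar>real (a u) - mu ^ k * real u\<bar> \<le> C" by blast
  have p: "0 \<le> mu ^ k" "mu ^ k \<le> 1" using mu_bounds by (auto intro: power_le_one)
  have "\<bar>real ((a \<circ> eta) u) - mu ^ Suc k * real u\<bar> \<le> C + 1" for u
  proof -
    have "\<bar>mu ^ k * real (eta u) - mu ^ k * (mu * u)\<bar> = mu ^ k * \<bar>real (eta u) - mu * u\<bar>"
      using p by (simp add: abs_mult right_diff_distrib[symmetric])
    also have "\<dots> \<le> 1 * 1" using p eta_bounds[of u] by (intro mult_mono) (auto simp: abs_le_iff)
    finally have "\<bar>mu ^ k * real (eta u) - mu ^ Suc k * u\<bar> \<le> 1" by (simp add: mult.assoc mult.left_commute)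
    then show ?thesis using C[of "eta u"] by simp
  qed
  then show ?case by blast
qed

lemma moves_vimage:
  assumes "inv_ideal J" "a \<in> moves" "A \<in> J"
  shows "a -` A \<in> J"
  using assms(2,3) by (induction arbitrary: A) (auto simp: vimage_comp[symmetric] inv_idealD[OF assms(1)])

text \<open>If \<open>W\<close> is not negligible, then the invariant ideal generated by \<open>J\<close> and \<open>W\<close> is larger than \<open>J\<close>; by maximality
it contains \<open>V\<close>.\<close>

lemma maximal_inv_ideal_cover:
  assumes J: "inv_ideal J" and max: "\<And>J'. inv_ideal J' \<Longrightarrow> J \<subseteq> J' \<Longrightarrow> V \<notin> J' \<Longrightarrow> J' = J"
    and W: "W \<notin> J"
  obtains I F where "I \<in> J" "finite F" "F \<subseteq> moves" "V \<subseteq> I \<union> (\<Union>a\<in>F. a -` W)"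
proof -
  define K where "K = {X. \<exists>I F. I \<in> J \<and> finite F \<and> F \<subseteq> moves \<and> X \<subseteq> I \<union> (\<Union>a\<in>F. a -` W)}"
  have KI: "X \<in> K" if "I \<in> J" "finite F" "F \<subseteq> moves" "X \<subseteq> I \<union> (\<Union>a\<in>F. a -` W)" for X I F
    using that unfolding K_def by blast
  have "inv_ideal K"
    unfolding inv_ideal_def
  proof (intro conjI ballI allI impI)
    show "{} \<in> K" by (rule KI[of "{}" "{}"]) (auto simp: inv_idealD[OF J])
    fix X assume "X \<in> K"
    then obtain I F where IF: "I \<in> J" "finite F" "F \<subseteq> moves" "X \<subseteq> I \<union> (\<Union>a\<in>F. a -` W)"
      unfolding K_def by blast
    show "Y \<in> K" if "Y \<subseteq> X" for Y by (rule KI[of I F]) (use IF that in auto)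
    show "Suc -` X \<in> K"
      by (rule KI[of "Suc -` I" "(\<lambda>a. a \<circ> Suc) ` F"]) (use IF inv_idealD(4)[OF J] in \<open>auto intro: moves.intros\<close>)
    show "eta -` X \<in> K"
      by (rule KI[of "eta -` I" "(\<lambda>a. a \<circ> eta) ` F"]) (use IF inv_idealD(5)[OF J] in \<open>auto intro: moves.intros\<close>)
    fix Y assume "Y \<in> K"
    then obtain I' F' where IF': "I' \<in> J" "finite F'" "F' \<subseteq> moves" "Y \<subseteq> I' \<union> (\<Union>a\<in>F'. a -` W)"
      unfolding K_def by blast
    show "X \<union> Y \<in> K"
      by (rule KI[of "I \<union> I'" "F \<union> F'"]) (use IF IF' inv_idealD(3)[OF J] in auto)
  qed
  moreover have "J \<subseteq> K" using KI[of _ "{}"] by auto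
  moreover have "W \<in> K"
    by (rule KI[of "{}" "{id}"]) (auto simp: inv_idealD[OF J] moves.id)
  then have "K \<noteq> J" using W by blast
  ultimately have "V \<in> K" using max by blast
  then show ?thesis using that unfolding K_def by blast
qed

text \<open>If no such \<open>P\<close> existed, then one could pass repeatedly from a set \<open>W\<close> to the non-negligible part of \<open>W\<close> on
which \<open>mean x\<close> leaves \<open>V\<close>, for some \<open>x\<close> in \<open>W\<close>. The chosen points would form an infinite subset of \<open>V\<close> all of whose
means avoid \<open>V\<close>.\<close>

lemma recurrent_subset_exists:
  assumes mean_recurrent: "mean_recurrent V" and J: "inv_ideal J" and fin: "\<And>A. finite A \<Longrightarrow> A \<in> J" and V: "V \<notin> J"
  obtains P where "P \<subseteq> V" "P \<notin> J" "\<forall>x\<in>P. {u\<in>P. mean x u \<notin> V} \<in> J"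
proof (rule ccontr)
  assume "\<not> thesis"
  note nt = this that
  define good where "good W \<longleftrightarrow> W \<subseteq> V \<and> W \<notin> J" for W
  have step: "\<exists>xW'. fst xW' \<in> W \<and> good (snd xW') \<and> snd xW' \<subseteq> W \<and>
      (\<forall>u\<in>snd xW'. fst xW' < u \<and> mean (fst xW') u \<notin> V)" if "good W" for W
  proof -
    have "\<not> (\<forall>x\<in>W. {u\<in>W. mean x u \<notin> V} \<in> J)" using nt(1) nt(2)[of W] that unfolding good_def by blast
    then obtain x where x: "x \<in> W" "{u\<in>W. mean x u \<notin> V} \<notin> J" by blast
    have "{u\<in>W. mean x u \<notin> V} \<subseteq> {u\<in>W. x < u \<and> mean x u \<notin> V} \<union> {..x}" by auto
    then have "{u\<in>W. x < u \<and> mean x u \<notin> V} \<notin> J"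
      using x(2) inv_idealD(2,3)[OF J] fin[of "{..x}"] by blast
    then show ?thesis using x(1) that
      by (intro exI[of _ "(x, {u\<in>W. x < u \<and> mean x u \<notin> V})"]) (auto simp: good_def)
  qed
  \<comment> \<open>The chosen point of \<open>W\<close>, and the set that replaces \<open>W\<close>.\<close>
  define nxt where "nxt W = (SOME xW'. fst xW' \<in> W \<and> good (snd xW') \<and> snd xW' \<subseteq> W \<and>
      (\<forall>u\<in>snd xW'. fst xW' < u \<and> mean (fst xW') u \<notin> V))" for W
  have nxt: "fst (nxt W) \<in> W" "good (snd (nxt W))" "snd (nxt W) \<subseteq> W"
      "\<And>u. u \<in> snd (nxt W) \<Longrightarrow> fst (nxt W) < u" "\<And>u. u \<in> snd (nxt W) \<Longrightarrow> mean (fst (nxt W)) u \<notin> V"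
    if "good W" for W
    using someI_ex[OF step[OF that]] unfolding nxt_def by blast+
  define Ws where "Ws = rec_nat V (\<lambda>_ W. snd (nxt W))"
  define xs where "xs i = fst (nxt (Ws i))" for i
  have Ws: "Ws 0 = V" "\<And>i. Ws (Suc i) = snd (nxt (Ws i))" by (simp_all add: Ws_def)
  have g: "good (Ws i)" for i by (induction i) (use V nxt(2) in \<open>auto simp: Ws good_def[of V]\<close>)
  have mono: "i \<le> j \<Longrightarrow> Ws j \<subseteq> Ws i" for i j
    by (rule lift_Suc_antimono_le) (use g nxt(3) Ws in auto)
  have xW: "xs i \<in> Ws i" for i using nxt(1)[OF g] by (simp add: xs_def)
  have lt: "xs i < xs j \<and> mean (xs i) (xs j) \<notin> V" if "i < j" for i j
  proof -
    have "xs j \<in> snd (nxt (Ws i))" using mono[of "Suc i" j] xW[of j] that Ws(2) by auto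
    then show ?thesis using nxt(4,5)[OF g] unfolding xs_def by blast
  qed
  have "strict_mono xs" using lt by (simp add: strict_mono_def)
  then have "infinite (range xs)" using range_inj_infinite strict_mono_imp_inj_on by blast
  moreover have "range xs \<subseteq> V" using xW g unfolding good_def by blast
  ultimately have "\<exists>x\<in>range xs. \<exists>y\<in>range xs. x < y \<and> n dvd m * x + l * y \<and> mean x y \<in> V"
    using mean_recurrent unfolding mean_recurrent_def by meson
  then obtain i j where "xs i < xs j" "mean (xs i) (xs j) \<in> V" by blast
  moreover have "i < j" using \<open>strict_mono xs\<close> \<open>xs i < xs j\<close> strict_mono_less by blast
  ultimately show False using lt by blast
qed

lemma mean_vimage:
  assumes "inv_ideal J" "X \<in> J"
  shows "{v. mean x v \<in> X} \<in> J"
proof -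
  have vim: "{v. v + d \<in> X} \<in> J" for d
  proof (induction d)
    case (Suc d)
    from inv_idealD(4)[OF assms(1) this] show ?case by (simp add: vimage_def)
  qed (use assms in auto)
  have "{v. mean x v \<in> X} \<subseteq> (\<Union>d\<in>{..x+1}. eta -` {v. v + d \<in> X})"
  proof
    fix v assume v: "v \<in> {v. mean x v \<in> X}"
    have "eta v \<le> mean x v" unfolding eta_def mean_def by (intro div_le_mono) simp
    moreover have "real (mean x v) \<le> x + real (eta v) + 1"
    proof -
      have "lam * real x \<le> 1 * real x" using mu_bounds by (intro mult_right_mono) auto
      then show ?thesis using mean_bounds(2)[of x v] eta_bounds(1)[of v] by linarith
    qed
    then have "mean x v \<le> x + eta v + 1" by linarith
    ultimately have "mean x v - eta v \<in> {..x+1}" "eta v + (mean x v - eta v) = mean x v" by auto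
    then show "v \<in> (\<Union>d\<in>{..x+1}. eta -` {v. v + d \<in> X})" using v by force
  qed
  moreover have "(\<Union>d\<in>{..x+1}. eta -` {v. v + d \<in> X}) \<in> J"
    by (rule inv_ideal_UN[OF assms(1)]) (use inv_idealD(5)[OF assms(1) vim] in \<open>simp_all add: vimage_def\<close>)
  ultimately show ?thesis using inv_idealD(2)[OF assms(1)] by blast
qed

end

section \<open>Reaching every point of a long interval\<close>

text \<open>A set \<open>V\<close> with a non-empty set \<open>P\<close> such that almost all means of a point of \<open>P\<close> with points of \<open>P\<close> fall
into \<open>V\<close>, and such that finitely many moves \<open>a \<in> A\<close> suffice to bring almost all points of \<open>V\<close> into \<open>P\<close>. Each move
multiplies by \<open>mu ^ kap a\<close>, up to an error of at most \<open>C0\<close>.\<close>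

locale recurrent = weights +
  fixes V P I :: "nat set" and J :: "nat set set" and A :: "(nat \<Rightarrow> nat) set"
    and kap :: "(nat \<Rightarrow> nat) \<Rightarrow> nat" and K0 :: nat and C0 :: real
  assumes J: "inv_ideal J" and fin: "\<And>X. finite X \<Longrightarrow> X \<in> J" and V: "V \<notin> J"
    and P_ne: "P \<noteq> {}"
    and P_good: "\<And>x. x \<in> P \<Longrightarrow> {u\<in>P. mean x u \<notin> V} \<in> J"
    and I: "I \<in> J" and A_fin: "finite A" and A_moves: "A \<subseteq> moves"
    and cover: "V \<subseteq> I \<union> (\<Union>a\<in>A. a -` P)"
    and kap_le: "\<And>a. a \<in> A \<Longrightarrow> kap a \<le> K0" and C0: "0 \<le> C0"
    and approx: "\<And>a u. a \<in> A \<Longrightarrow> \<bar>real (a u) - mu ^ kap a * real u\<bar> \<le> C0"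
begin

text \<open>The property holds for all points of \<open>V\<close> outside a negligible set.\<close>

definition almost_all :: "(nat \<Rightarrow> bool) \<Rightarrow> bool" where
  "almost_all Q \<longleftrightarrow> {u\<in>V. \<not> Q u} \<in> J"

lemma almost_all_mono: "almost_all Q \<Longrightarrow> (\<And>u. u \<in> V \<Longrightarrow> Q u \<Longrightarrow> R u) \<Longrightarrow> almost_all R"
  unfolding almost_all_def by (rule inv_idealD(2)[OF J]) auto

lemma almost_all_conj: 
  assumes "almost_all Q" "almost_all R" shows "almost_all (\<lambda>u. Q u \<and> R u)"
proof -
  have "{u\<in>V. \<not> Q u} \<union> {u\<in>V. \<not> R u} \<in> J" using assms inv_idealD(3)[OF J] by (simp add: almost_all_def)
  then show ?thesis unfolding almost_all_def by (rule inv_idealD(2)[OF J]) auto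
qed

lemma almost_all_ball: "finite F \<Longrightarrow> (\<And>t. t \<in> F \<Longrightarrow> almost_all (Q t)) \<Longrightarrow> almost_all (\<lambda>u. \<forall>t\<in>F. Q t u)"
proof (induction F rule: finite_induct)
  case empty
  then show ?case using inv_idealD(1)[OF J] by (simp add: almost_all_def)
next
  case (insert x F)
  then have "almost_all (\<lambda>u. Q x u \<and> (\<forall>t\<in>F. Q t u))" 
    by (intro almost_all_conj[of "Q x"]) simp_all
  then show ?case by simp
qed

lemma almost_all_large: "almost_all (\<lambda>u. N \<le> real u)"
  unfolding almost_all_def
proof (rule fin)
  have "u \<le> nat \<lceil>N\<rceil>" if "\<not> N \<le> real u" for u using that by linarith
  then have "{u\<in>V. \<not> N \<le> real u} \<subseteq> {..nat \<lceil>N\<rceil>}" by blast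
  then show "finite {u\<in>V. \<not> N \<le> real u}" using finite_subset by blast
qed

lemma almost_all_ex: 
  assumes "almost_all Q" shows "\<exists>u\<in>V. Q u"
proof (rule ccontr)
  assume "\<not> ?thesis"
  then have "{u\<in>V. \<not> Q u} = V" by blast
  then show False using assms V by (simp add: almost_all_def)
qed

text \<open>The basic step: almost every point \<open>u\<close> of \<open>V\<close> can be moved into \<open>P\<close> by some \<open>a\<close> in \<open>A\<close>, and its mean with a
point of \<open>P\<close>, prescribed in advance for each \<open>a\<close>, is again a point of \<open>V\<close> that is typical in any
prescribed sense.\<close>

lemma almost_all_step:
  assumes xs: "\<And>a. a \<in> A \<Longrightarrow> xs a \<in> P" and Q: "\<And>a. a \<in> A \<Longrightarrow> almost_all (Q a)"
  shows "almost_all (\<lambda>u. \<exists>a\<in>A. a u \<in> P \<and> mean (xs a) (a u) \<in> V \<and> Q a (mean (xs a) (a u)))"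
proof -
  define B where "B a = {v\<in>P. mean (xs a) v \<notin> V} \<union> {v. mean (xs a) v \<in> {w\<in>V. \<not> Q a w}}" for a
  have "B a \<in> J" if "a \<in> A" for a
    unfolding B_def using mean_vimage[OF J Q[OF that, unfolded almost_all_def]] P_good[OF xs[OF that]]
    by (rule inv_idealD(3)[OF J, rotated])
  then have "(\<Union>a\<in>A. a -` B a) \<in> J"
    by (intro inv_ideal_UN[OF J A_fin] moves_vimage[OF J]) (use A_moves in auto)
  then have "I \<union> (\<Union>a\<in>A. a -` B a) \<in> J" using I inv_idealD(3)[OF J] by blast
  moreover have "{u\<in>V. \<not> (\<exists>a\<in>A. a u \<in> P \<and> mean (xs a) (a u) \<in> V \<and> Q a (mean (xs a) (a u)))}
      \<subseteq> I \<union> (\<Union>a\<in>A. a -` B a)"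
  proof
    fix u assume u: "u \<in> {u\<in>V. \<not> (\<exists>a\<in>A. a u \<in> P \<and> mean (xs a) (a u) \<in> V \<and> Q a (mean (xs a) (a u)))}"
    show "u \<in> I \<union> (\<Union>a\<in>A. a -` B a)"
    proof (cases "u \<in> I")
      case False
      then obtain a where a: "a \<in> A" "a u \<in> P" using cover u by blast
      then have "a u \<in> B a" using u unfolding B_def by blast
      then show ?thesis using a by blast
    qed simp
  qed
  ultimately show ?thesis unfolding almost_all_def using inv_idealD(2)[OF J] by blast
qed

text \<open>The error of one such step.\<close>

definition C1 :: real where "C1 = C0 + 1"

lemma step_value:
  assumes a: "a \<in> A"
  shows "\<bar>real (mean x (a u)) - (lam * x + mu ^ (kap a + 1) * u)\<bar> \<le> C1"
proof -
  have "\<bar>mu * real (a u) - mu * (mu ^ kap a * u)\<bar> = mu * \<bar>real (a u) - mu ^ kap a * u\<bar>"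
    using mu_bounds by (simp add: abs_mult right_diff_distrib[symmetric])
  also have "\<dots> \<le> 1 * C0" using mu_bounds approx[OF a, of u] by (intro mult_mono) auto
  finally have "\<bar>mu * real (a u) - mu ^ (kap a + 1) * u\<bar> \<le> C0" by (simp add: mult.assoc)
  then show ?thesis using mean_bounds[of x "a u"] unfolding C1_def by linarith
qed

text \<open>One step shrinks a large point at least by the factor \<open>nu\<close>, and at most by the factor \<open>q\<close>.\<close>

definition q :: real where "q = mu ^ (K0 + 1) / 2"
definition nu :: real where "nu = (1 + mu) / 2"

lemma q_bounds: "0 < q" "q < 1" "q \<le> mu ^ K0 / 2"
  using mu_power[of "K0+1"] mu_power_le[of K0 "K0+1"] unfolding q_def by auto

lemma nu_bounds: "0 < nu" "nu < 1" "mu < nu" using mu_bounds by (auto simp: nu_def)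

text \<open>Below almost every point \<open>u\<close> of \<open>V\<close>, as far down as \<open>nu ^ s * u\<close>, the set \<open>P\<close> comes within the
constant factor \<open>2 / q\<close> of every real number: take steps with a fixed point of \<open>P\<close>, and note that each
step starts by moving into \<open>P\<close>.\<close>

lemma log_dense:
  "almost_all (\<lambda>u. \<forall>R::real. nu ^ s * u \<le> R \<and> R \<le> u \<longrightarrow> (\<exists>p\<in>P. q * R \<le> 2 * real p \<and> q * real p \<le> 2 * R))"
proof (induction s)
  have near: "\<exists>p\<in>P. q * R \<le> 2 * real p \<and> q * real p \<le> 2 * R"
    if u: "C0 \<le> real u" "2 * C0 \<le> mu ^ K0 * u" and a: "a \<in> A" "a u \<in> P" and R: "q * u \<le> R" "R \<le> u" for u a and R :: real
  proof -
    have "real (a u) \<le> mu ^ kap a * u + C0" "mu ^ kap a * u - C0 \<le> real (a u)"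
      using approx[OF a(1), of u] by auto
    moreover have "mu ^ K0 * u \<le> mu ^ kap a * u" using mu_power_le[OF kap_le[OF a(1)]] by (intro mult_right_mono) auto
    moreover have "mu ^ kap a * u \<le> 1 * real u" using mu_power by (intro mult_right_mono) auto
    ultimately have au: "real (a u) \<le> 2 * u" "mu ^ K0 * u \<le> 2 * real (a u)" using u by linarith+
    have "q * R \<le> q * u" using R q_bounds by (intro mult_left_mono) auto
    also have "\<dots> \<le> mu ^ K0 / 2 * u" using q_bounds by (intro mult_right_mono) auto
    finally have "q * R \<le> 2 * real (a u)" using au(2) by simp
    moreover have "q * a u \<le> q * (2 * u)" using au(1) q_bounds by (intro mult_left_mono) auto
    then have "q * a u \<le> 2 * R" using R by linarith
    ultimately show ?thesis using a(2) by blast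
  qed
  obtain x0 where x0: "x0 \<in> P" using P_ne by blast
  {
    case 0
    have "almost_all (\<lambda>u. \<exists>a\<in>A. a u \<in> P \<and> mean x0 (a u) \<in> V \<and> 0 \<le> real (mean x0 (a u)))"
      by (rule almost_all_step) (use x0 almost_all_large[of 0] in auto)
    then show ?case
    proof (rule almost_all_mono[OF almost_all_conj[OF _ almost_all_conj[OF almost_all_large almost_all_large]]], intro allI impI)
      fix u R
      assume "(\<exists>a\<in>A. a u \<in> P \<and> mean x0 (a u) \<in> V \<and> 0 \<le> real (mean x0 (a u))) \<and> C0 \<le> real u \<and> 2 * C0 / mu ^ K0 \<le> real u"
        and "nu ^ 0 * real u \<le> R \<and> R \<le> real u"
      then obtain a where a: "a \<in> A" "a u \<in> P" "C0 \<le> real u" "2 * C0 / mu ^ K0 \<le> real u" 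
        and R: "nu ^ 0 * real u \<le> R" "R \<le> real u" by blast
      have Ru: "R = u" using R by simp
      have "2 * C0 \<le> mu ^ K0 * u" using a(4) mu_power[of K0] by (simp add: pos_divide_le_eq mult.commute)
      moreover have "q * u \<le> 1 * real u" using q_bounds by (intro mult_right_mono) auto
      ultimately show "\<exists>p\<in>P. q * R \<le> 2 * real p \<and> q * real p \<le> 2 * R" 
        unfolding Ru by (intro near[OF a(3) _ a(1,2)]) simp_all
    qed
  next
    case (Suc s)
    define Q where "Q u \<longleftrightarrow> (\<forall>R::real. nu ^ s * real u \<le> R \<and> R \<le> u \<longrightarrow> (\<exists>p\<in>P. q * R \<le> 2 * real p \<and> q * real p \<le> 2 * R))" for u
    have "almost_all (\<lambda>u. \<exists>a\<in>A. a u \<in> P \<and> mean x0 (a u) \<in> V \<and> Q (mean x0 (a u)))"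
      by (rule almost_all_step[OF x0]) (use Suc in \<open>simp only: Q_def\<close>)
    from almost_all_conj[OF this almost_all_conj[OF almost_all_conj[OF almost_all_large[of C0] almost_all_large[of "2 * C0 / mu ^ K0"]] 
        almost_all_conj[OF almost_all_large[of "(lam * x0 + C1) / (nu - mu)"] almost_all_large[of "C1 / q"]]]]
    show ?case
    proof (rule almost_all_mono, intro allI impI)
      fix u R
      assume H: "(\<exists>a\<in>A. a u \<in> P \<and> mean x0 (a u) \<in> V \<and> Q (mean x0 (a u))) \<and> 
          (C0 \<le> real u \<and> 2 * C0 / mu ^ K0 \<le> real u) \<and> (lam * x0 + C1) / (nu - mu) \<le> real u \<and> C1 / q \<le> real u"
        and R: "nu ^ Suc s * real u \<le> R \<and> R \<le> real u"
      then obtain a where a: "a \<in> A" "a u \<in> P" "Q (mean x0 (a u))" by blast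
      from H have H: "C0 \<le> real u" "2 * C0 / mu ^ K0 \<le> real u" "(lam * x0 + C1) / (nu - mu) \<le> real u" "C1 / q \<le> real u"
        by simp_all
      have big: "C0 \<le> real u" "2 * C0 \<le> mu ^ K0 * u" "lam * x0 + C1 \<le> (nu - mu) * u" "C1 \<le> q * u"
        using H mu_power[of K0] nu_bounds q_bounds by (auto simp: pos_divide_le_eq mult.commute)
      define w where "w = real (mean x0 (a u))"
      have w: "w \<le> lam * x0 + mu ^ (kap a + 1) * u + C1" "lam * x0 + mu ^ (kap a + 1) * u - C1 \<le> w" 
        using step_value[OF a(1), of x0 u] by (auto simp: w_def)
      have "mu ^ (kap a + 1) * u \<le> mu * u" using mu_power_le[of 1 "kap a + 1"] by (intro mult_right_mono) auto
      then have w1: "w \<le> nu * u" using w(1) big(3) by (simp add: algebra_simps)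
      have "mu ^ (K0 + 1) * u \<le> mu ^ (kap a + 1) * u" 
        using mu_power_le[of "kap a + 1" "K0 + 1"] kap_le[OF a(1)] by (intro mult_right_mono) auto
      moreover have "mu ^ (K0 + 1) * u = 2 * (q * u)" by (simp add: q_def)
      moreover have "0 \<le> lam * x0" using mu_bounds by simp
      ultimately have w2: "q * u \<le> w" using w(2) big(4) by linarith
      show "\<exists>p\<in>P. q * R \<le> 2 * real p \<and> q * real p \<le> 2 * R"
      proof (cases "R \<le> w")
        case True
        have "nu ^ s * w \<le> nu ^ s * (nu * u)" using w1 nu_bounds by (intro mult_left_mono) auto
        then have "nu ^ s * w \<le> R" using R by (simp add: mult.assoc mult.left_commute)
        then show ?thesis using a(3) True unfolding Q_def w_def by blast
      next
        case False
        then show ?thesis by (intro near[OF big(1,2) a(1,2)]) (use R w2 in simp_all)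
      qed
    qed
  }
qed

text \<open>With this constant, \<open>P\<close> meets \<open>[R / Dens, R]\<close> for all \<open>R\<close> in arbitrarily long ranges.\<close>

definition Dens :: real where "Dens = (2 / q)\<^sup>2"

lemma Dens_ge: "1 \<le> Dens"
  using q_bounds unfolding Dens_def by (intro one_le_power) (simp add: pos_le_divide_eq)

lemma dense_on_long_ranges:
  fixes M Bd :: real
  assumes M: "1 \<le> M"
  shows "\<exists>R0\<ge>Bd. \<forall>R::real. R0 \<le> R \<and> R \<le> M * R0 \<longrightarrow> (\<exists>p\<in>P. R / Dens \<le> p \<and> p \<le> R)"
proof -
  obtain s where s: "nu ^ s < 1 / M" using real_arch_pow_inv[of "1/M" nu] M nu_bounds by auto
  obtain u where u: "u \<in> V" "M * \<bar>Bd\<bar> \<le> real u" 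
    "\<forall>R::real. nu ^ s * u \<le> R \<and> R \<le> u \<longrightarrow> (\<exists>p\<in>P. q * R \<le> 2 * real p \<and> q * real p \<le> 2 * R)"
    using almost_all_ex[OF almost_all_conj[OF almost_all_large log_dense[of s]]] by blast
  define R0 where "R0 = 2 / q * (u / M)"
  show ?thesis
  proof (intro exI[of _ R0] conjI allI impI)
    have "\<bar>Bd\<bar> \<le> u / M" using u(2) M by (simp add: pos_le_divide_eq mult.commute)
    also have "1 * (u / M) \<le> 2 / q * (u / M)" 
      using q_bounds M by (intro mult_right_mono) (auto simp: pos_le_divide_eq)
    finally show "Bd \<le> R0" unfolding R0_def by simp
    fix R assume R: "R0 \<le> R \<and> R \<le> M * R0"
    define R' where "R' = q / 2 * R"
    have RR: "R = 2 / q * R'" using q_bounds by (simp add: R'_def)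
    have i: "q / 2 * R0 \<le> R'" "R' \<le> q / 2 * (M * R0)" 
      unfolding R'_def using R q_bounds by (auto intro!: mult_left_mono)
    have ii: "q / 2 * R0 = u / M" "q / 2 * (M * R0) = u" using q_bounds M by (simp_all add: R0_def)
    note R'u = i(1)[unfolded ii] i(2)[unfolded ii]
    have "nu ^ s * u \<le> 1 / M * u" using s by (intro mult_right_mono) auto
    then have "nu ^ s * u \<le> R'" using R'u by simp
    then obtain p where p: "p \<in> P" "q * R' \<le> 2 * real p" "q * real p \<le> 2 * R'" using u(3) R'u by blast
    have "R / Dens = q / 2 * R'" using q_bounds unfolding RR Dens_def by (simp add: power2_eq_square)
    then have "R / Dens \<le> p" using p(2) by linarith
    moreover have "p \<le> R" using p(3) q_bounds unfolding RR by (simp add: pos_le_divide_eq mult.commute)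
    ultimately show "\<exists>p\<in>P. R / Dens \<le> p \<and> p \<le> R" using p(1) by blast
  qed
qed

text \<open>The factor by which the distance to the target, relative to the scale, decreases in each step of the
next lemma.\<close>

definition shrink :: real where "shrink = 1 - 1 / (2 * Dens)"

lemma shrink_bounds: "0 < shrink" "shrink < 1" using Dens_ge by (auto simp: shrink_def pos_divide_less_eq)

text \<open>Greedy approach to the target \<open>u + R\<close>. A move by \<open>a\<close> turns the distance \<open>R\<close> into
\<open>R' = mu ^ (kap a + 1) * R\<close>, and taking the mean with \<open>x\<close> from \<open>P\<close> reduces this by \<open>lam * x\<close>. By density there is an \<open>x\<close>
for which \<open>lam * x\<close> lies between \<open>R' / (2 * Dens)\<close> and \<open>R' / 2\<close>.\<close>

lemma reach:
  fixes R :: real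
  assumes "0 < R" "\<And>R'::real. q ^ s * R / lam \<le> R' \<Longrightarrow> R' \<le> R / lam \<Longrightarrow> \<exists>p\<in>P. R' / Dens \<le> p \<and> p \<le> R'"
  shows "almost_all (\<lambda>u. \<exists>j\<le>s * (K0 + 1). \<exists>w\<in>V. \<bar>real w - mu ^ j * (real u + R)\<bar> \<le> shrink ^ s * (mu ^ j * R) + s * C1)"
  using assms
proof (induction s arbitrary: R)
  case 0
  show ?case using almost_all_large[of 0] by (rule almost_all_mono) (use 0 in \<open>auto intro!: bexI\<close>)
next
  case (Suc s)
  define R' where "R' a = mu ^ (kap a + 1) * R" for a
  have R'_le: "R' a \<le> R" for a 
    using mult_right_mono[OF mu_power(2)[of "kap a + 1"], of R] Suc.prems(1) by (simp add: R'_def)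
  have R'_ge: "q * R \<le> R' a / 2" if "a \<in> A" for a
  proof -
    have "mu ^ (K0 + 1) * R \<le> R' a" unfolding R'_def
      using mu_power_le[of "kap a + 1" "K0 + 1"] kap_le[OF that] Suc.prems(1) by (intro mult_right_mono) auto
    then show ?thesis by (simp add: q_def)
  qed
  have lam0: "0 < lam" using mu_bounds by simp
  have "\<exists>x\<in>P. R' a / (2 * lam) / Dens \<le> x \<and> x \<le> R' a / (2 * lam)" if a: "a \<in> A" for a
  proof (rule Suc.prems(2))
    have "q ^ Suc s * R \<le> q * R" using q_bounds Suc.prems(1) by (intro mult_right_mono) (auto intro: mult_left_le power_le_one)
    then have "q ^ Suc s * R \<le> R' a / 2" using R'_ge[OF a] by linarith
    then have "q ^ Suc s * R / lam \<le> (R' a / 2) / lam" using lam0 by (intro divide_right_mono) auto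
    then show "q ^ Suc s * R / lam \<le> R' a / (2 * lam)" by simp
    have "R' a / 2 \<le> R" using R'_le[of a] Suc.prems(1) by simp
    then have "(R' a / 2) / lam \<le> R / lam" using lam0 by (intro divide_right_mono) auto
    then show "R' a / (2 * lam) \<le> R / lam" by simp
  qed
  then obtain xs where xs: "\<And>a. a \<in> A \<Longrightarrow> xs a \<in> P" 
     "\<And>a. a \<in> A \<Longrightarrow> R' a / (2 * lam) / Dens \<le> real (xs a)" "\<And>a. a \<in> A \<Longrightarrow> real (xs a) \<le> R' a / (2 * lam)"
    by metis
  define R1 where "R1 a = R' a - lam * xs a" for a
  have R1: "q * R \<le> R1 a" "R1 a \<le> shrink * R' a" if a: "a \<in> A" for a
  proof -
    have "lam * xs a \<le> lam * (R' a / (2 * lam))" using xs(3)[OF a] lam0 by (intro mult_left_mono) auto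
    then have "lam * xs a \<le> R' a / 2" using lam0 by simp
    then show "q * R \<le> R1 a" using R'_ge[OF a] unfolding R1_def by linarith
    have "lam * (R' a / (2 * lam) / Dens) \<le> lam * xs a" using xs(2)[OF a] lam0 by (intro mult_left_mono) auto
    then have "R' a / (2 * Dens) \<le> lam * xs a" using lam0 by simp
    then show "R1 a \<le> shrink * R' a" unfolding R1_def shrink_def by (simp add: left_diff_distrib)
  qed
  have R1_le: "R1 a \<le> R" for a using R'_le[of a] lam0 unfolding R1_def by (smt (verit) mult_nonneg_nonneg of_nat_0_le_iff)
  define Q where "Q a u \<longleftrightarrow> (\<exists>j\<le>s * (K0 + 1). \<exists>w\<in>V. \<bar>real w - mu ^ j * (real u + R1 a)\<bar> \<le> shrink ^ s * (mu ^ j * R1 a) + s * C1)" for a u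
  have "almost_all (Q a)" if a: "a \<in> A" for a
    unfolding Q_def
  proof (rule Suc.IH)
    show "0 < R1 a" using R1(1)[OF a] q_bounds Suc.prems(1) by (smt (verit) mult_pos_pos)
    fix R' assume "q ^ s * R1 a / lam \<le> R'" "R' \<le> R1 a / lam"
    moreover have "q ^ s * (q * R) \<le> q ^ s * R1 a" using R1(1)[OF a] q_bounds by (intro mult_left_mono) auto
    then have "q ^ Suc s * R / lam \<le> q ^ s * R1 a / lam" using lam0 by (intro divide_right_mono) (auto simp: mult_ac)
    moreover have "R1 a / lam \<le> R / lam" using R1_le[of a] lam0 by (intro divide_right_mono) auto
    ultimately show "\<exists>p\<in>P. R' / Dens \<le> p \<and> p \<le> R'" using Suc.prems(2) by auto
  qed
  from almost_all_step[OF xs(1) this] show ?case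
  proof (rule almost_all_mono)
    fix u assume "\<exists>a\<in>A. a u \<in> P \<and> mean (xs a) (a u) \<in> V \<and> Q a (mean (xs a) (a u))"
    then obtain a j w where a: "a \<in> A" and j: "j \<le> s * (K0 + 1)" and w: "w \<in> V"
      "\<bar>real w - mu ^ j * (real (mean (xs a) (a u)) + R1 a)\<bar> \<le> shrink ^ s * (mu ^ j * R1 a) + s * C1"
      unfolding Q_def by blast
    define k where "k = kap a + 1"
    define d where "d = real (mean (xs a) (a u)) - (lam * xs a + mu ^ k * u)"
    have d: "\<bar>d\<bar> \<le> C1" using step_value[OF a] unfolding d_def k_def by blast
    have e: "real (mean (xs a) (a u)) + R1 a = mu ^ k * (u + R) + d"
      unfolding d_def R1_def R'_def k_def by (simp only: distrib_left)
    have "\<bar>mu ^ j * d\<bar> = mu ^ j * \<bar>d\<bar>" using mu_power(1)[of j] by (simp add: abs_mult)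
    also have "\<dots> \<le> 1 * C1" using mu_power[of j] d by (intro mult_mono) auto
    finally have dj: "\<bar>mu ^ j * d\<bar> \<le> C1" by simp
    have e2: "mu ^ j * (real (mean (xs a) (a u)) + R1 a) = mu ^ (j + k) * (u + R) + mu ^ j * d"
      unfolding e by (simp add: distrib_left power_add mult_ac)
    have "shrink ^ s * (mu ^ j * R1 a) \<le> shrink ^ s * (mu ^ j * (shrink * R' a))"
      using R1(2)[OF a] shrink_bounds mu_power(1)[of j] by (intro mult_left_mono) auto
    also have "\<dots> = shrink ^ Suc s * (mu ^ (j + k) * R)" by (simp add: R'_def k_def power_add mult_ac)
    finally have "\<bar>real w - mu ^ (j + k) * (u + R)\<bar> \<le> shrink ^ Suc s * (mu ^ (j + k) * R) + s * C1 + C1"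
      using w(2) dj unfolding e2 by linarith
    also have "\<dots> = shrink ^ Suc s * (mu ^ (j + k) * R) + Suc s * C1" by (simp add: algebra_simps)
    finally show "\<exists>j\<le>Suc s * (K0 + 1). \<exists>w\<in>V. \<bar>real w - mu ^ j * (real u + R)\<bar> \<le> shrink ^ Suc s * (mu ^ j * R) + real (Suc s) * C1"
      using w(1) j kap_le[OF a] by (intro exI[of _ "j + k"]) (auto simp: k_def)
  qed
qed

text \<open>The targets are \<open>u + t * mu ^ (- E)\<close>. The exponent \<open>E\<close> has to be chosen such that \<open>P\<close> is dense on all
the ranges that the greedy approach uses, and large compared with the number \<open>s\<close> of its steps.\<close>

lemma fill_interval:
  assumes T: "1 \<le> T"
  shows "\<exists>E. almost_all (\<lambda>u. \<forall>t\<in>{T..T + N}. \<exists>j\<le>E. \<exists>w\<in>V. \<bar>mu ^ (E - j) * real w - (mu ^ E * real u + real t)\<bar> \<le> 2)"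
proof -
  define rho where "rho = 1 / mu"
  have rho: "1 < rho" "rho * mu = 1" using mu_bounds by (auto simp: rho_def)
  have rp: "mu ^ i * rho ^ i = 1" for i 
    using rho by (metis mult.commute power_mult_distrib power_one)
  \<comment> \<open>After \<open>s\<close> steps, the remaining distance is at most one on the final scale.\<close>
  define tau where "tau = real (T + N)"
  have tau: "1 \<le> tau" using T by (simp add: tau_def)
  obtain s where s: "shrink ^ s < 1 / tau" using real_arch_pow_inv[of "1/tau" shrink] tau shrink_bounds by auto
  have C1: "0 < C1" using C0 by (simp add: C1_def)
  \<comment> \<open>Contraction by \<open>mu ^ e\<close> makes the total rounding error of the \<open>s\<close> steps at most one.\<close>
  obtain e where e: "mu ^ e < 1 / (s * C1 + 1)" 
    using real_arch_pow_inv[of "1 / (s * C1 + 1)" mu] C1 mu_bounds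
    by (smt (verit) divide_pos_pos mult_nonneg_nonneg of_nat_0_le_iff)
  define a0 where "a0 = q ^ s * T / lam"
  have a0: "0 < a0" using q_bounds T mu_bounds by (simp add: a0_def)
  define M where "M = tau / (q ^ s * T) * rho"
  have qs: "0 < q ^ s" "q ^ s \<le> 1" using q_bounds by (auto intro: power_le_one)
  have "q ^ s * T \<le> 1 * tau" using qs unfolding tau_def by (intro mult_mono) auto
  then have "1 \<le> tau / (q ^ s * T)" using qs T by (simp add: pos_le_divide_eq)
  then have "1 * 1 \<le> M" unfolding M_def using rho by (intro mult_mono) auto
  then obtain R0 where R0: "R0 \<ge> a0 * rho ^ (s * (K0 + 1) + e) + 1"
    "\<And>R. R0 \<le> R \<Longrightarrow> R \<le> M * R0 \<Longrightarrow> (\<exists>p\<in>P. R / Dens \<le> p \<and> p \<le> R)"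
    using dense_on_long_ranges by (metis mult_1)
  have "0 < R0" using R0(1) a0 rho by (smt (verit) mult_pos_pos zero_less_power)
  obtain E' where "R0 / a0 < rho ^ E'" using real_arch_pow[OF rho(1)] by blast
  then have E': "R0 \<le> a0 * rho ^ E'" using a0 by (simp add: pos_divide_less_eq mult.commute)
  \<comment> \<open>By minimality, the lower end \<open>a0 * rho ^ E\<close> of the required range is between \<open>R0\<close> and \<open>rho * R0\<close>.\<close>
  define E where "E = (LEAST E. R0 \<le> a0 * rho ^ E)"
  have E1: "R0 \<le> a0 * rho ^ E" unfolding E_def using E' by (rule LeastI)
  have E_ge: "s * (K0 + 1) + e < E"
  proof (rule ccontr)
    assume "\<not> ?thesis"
    then have "rho ^ E \<le> rho ^ (s * (K0 + 1) + e)" using rho by (intro power_increasing) auto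
    then have "a0 * rho ^ E \<le> a0 * rho ^ (s * (K0 + 1) + e)" using a0 by (intro mult_left_mono) auto
    then show False using E1 R0(1) by linarith
  qed
  then obtain E0 where E0: "E = Suc E0" by (cases E) auto
  have "\<not> R0 \<le> a0 * rho ^ E0" using not_less_Least[of E0 "\<lambda>E. R0 \<le> a0 * rho ^ E"] E0 unfolding E_def by auto
  then have E2: "a0 * rho ^ E \<le> rho * R0" using E0 rho by (simp add: mult.left_commute)
  have each: "almost_all (\<lambda>u. \<exists>j\<le>E. \<exists>w\<in>V. \<bar>mu ^ (E - j) * real w - (mu ^ E * real u + real t)\<bar> \<le> 2)"
    if t: "t \<in> {T..T + N}" for t
  proof -
    define R where "R = t * rho ^ E"
    have "0 < R" using t T rho by (simp add: R_def)
    have "almost_all (\<lambda>u. \<exists>j\<le>s * (K0 + 1). \<exists>w\<in>V. \<bar>real w - mu ^ j * (real u + R)\<bar> \<le> shrink ^ s * (mu ^ j * R) + s * C1)"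
    proof (rule reach[OF \<open>0 < R\<close>], rule R0(2))
      fix R' assume R': "q ^ s * R / lam \<le> R'" "R' \<le> R / lam"
      have "T * rho ^ E \<le> R" unfolding R_def using t rho by (intro mult_right_mono) auto
      then have "q ^ s * (T * rho ^ E) / lam \<le> q ^ s * R / lam" 
        using qs mu_bounds by (intro divide_right_mono mult_left_mono) auto
      then have "a0 * rho ^ E \<le> q ^ s * R / lam" by (simp add: a0_def mult_ac)
      then show "R0 \<le> R'" using E1 R' by linarith
      have "R \<le> tau * rho ^ E" unfolding R_def tau_def using t rho by (intro mult_right_mono) auto
      then have "R / lam \<le> tau * rho ^ E / lam" using mu_bounds by (intro divide_right_mono) auto
      also have "\<dots> = tau / (q ^ s * T) * (a0 * rho ^ E)" using q_bounds mu_bounds T by (simp add: a0_def)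
      also have "\<dots> \<le> tau / (q ^ s * T) * (rho * R0)" using E2 tau qs T by (intro mult_left_mono) auto
      also have "\<dots> = M * R0" by (simp add: M_def)
      finally show "R' \<le> M * R0" using R' by linarith
    qed
    then show ?thesis
    proof (rule almost_all_mono)
      fix u assume "\<exists>j\<le>s * (K0 + 1). \<exists>w\<in>V. \<bar>real w - mu ^ j * (real u + R)\<bar> \<le> shrink ^ s * (mu ^ j * R) + s * C1"
      then obtain j w where j: "j \<le> s * (K0 + 1)" and w: "w \<in> V"
        "\<bar>real w - mu ^ j * (real u + R)\<bar> \<le> shrink ^ s * (mu ^ j * R) + s * C1" by blast
      have jE: "j \<le> E" "e \<le> E - j" using j E_ge by auto
      define x where "x = mu ^ (E - j)"
      have x: "0 < x" "x \<le> mu ^ e" using mu_power mu_power_le[OF jE(2)] by (auto simp: x_def)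
      have "x * mu ^ j = mu ^ E" using jE by (simp add: x_def power_add[symmetric])
      then have xm: "x * (mu ^ j * z) = mu ^ E * z" for z by (simp add: mult.assoc[symmetric])
      have ER: "mu ^ E * R = t" using rp[of E] by (simp add: R_def mult_ac)
      have "\<bar>x * real w - x * (mu ^ j * (real u + R))\<bar> = x * \<bar>real w - mu ^ j * (real u + R)\<bar>"
        using x by (simp add: abs_mult right_diff_distrib[symmetric])
      also have "\<dots> \<le> x * (shrink ^ s * (mu ^ j * R) + s * C1)" using w(2) x by (intro mult_left_mono) auto
      also have "\<dots> = shrink ^ s * (x * (mu ^ j * R)) + x * (s * C1)" by (simp add: algebra_simps)
      also have "\<dots> = shrink ^ s * t + x * (s * C1)" by (simp only: xm ER)
      also have "\<dots> \<le> 1 + 1"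
      proof (rule add_mono)
        have "shrink ^ s * t \<le> 1 / tau * tau" using s t shrink_bounds tau by (intro mult_mono) (auto simp: tau_def)
        then show "shrink ^ s * t \<le> 1" using tau by simp
        have "x * (s * C1) \<le> 1 / (s * C1 + 1) * (s * C1)" using x e C1 by (intro mult_right_mono) auto
        also have "\<dots> \<le> 1 / (s * C1 + 1) * (s * C1 + 1)" 
          using C1 by (intro mult_left_mono) auto
        also have "\<dots> = 1" using C1 by (simp add: add_nonneg_eq_0_iff)
        finally show "x * (s * C1) \<le> 1" .
      qed
      finally have "\<bar>x * real w - (mu ^ E * u + t)\<bar> \<le> 2" unfolding xm by (simp add: distrib_left ER)
      then show "\<exists>j\<le>E. \<exists>w\<in>V. \<bar>mu ^ (E - j) * real w - (mu ^ E * real u + real t)\<bar> \<le> 2"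
        using jE w(1) unfolding x_def by blast
    qed
  qed
  show ?thesis by (rule exI[of _ E], rule almost_all_ball[OF finite_atLeastAtMost], rule each)
qed

end

context weights
begin

text \<open>The hypotheses of the locale hold for any ideal maximal among the invariant ideals without \<open>V\<close>.\<close>

lemma fill_interval_maximal:
  assumes mean_recurrent: "mean_recurrent V" and J: "inv_ideal J" and fin: "\<And>X. finite X \<Longrightarrow> X \<in> J" and V: "V \<notin> J"
    and max: "\<And>J'. inv_ideal J' \<Longrightarrow> J \<subseteq> J' \<Longrightarrow> V \<notin> J' \<Longrightarrow> J' = J"
    and T: "1 \<le> T"
  shows "\<exists>E. {u\<in>V. \<not> (\<forall>t\<in>{T..T + N}. \<exists>j\<le>E. \<exists>w\<in>V.
           \<bar>mu ^ (E - j) * real w - (mu ^ E * real u + real t)\<bar> \<le> 2)} \<in> J"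
proof -
  obtain P where P: "P \<subseteq> V" "P \<notin> J" "\<forall>x\<in>P. {u\<in>P. mean x u \<notin> V} \<in> J"
    using recurrent_subset_exists[OF mean_recurrent J fin V] .
  obtain I A where A: "I \<in> J" "finite A" "A \<subseteq> moves" "V \<subseteq> I \<union> (\<Union>a\<in>A. a -` P)"
    by (rule maximal_inv_ideal_cover[OF J max P(2)])
  have "\<forall>a\<in>A. \<exists>k C. \<forall>u. \<bar>real (a u) - mu ^ k * real u\<bar> \<le> C" using A(3) moves_approx by blast
  then obtain kap C where kC: "\<And>a u. a \<in> A \<Longrightarrow> \<bar>real (a u) - mu ^ kap a * real u\<bar> \<le> C a" by metis
  define K0 where "K0 = (\<Sum>a\<in>A. kap a)"
  define C0 where "C0 = (\<Sum>a\<in>A. \<bar>C a\<bar>)"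
  have C0: "\<bar>C a\<bar> \<le> C0" if "a \<in> A" for a unfolding C0_def using A(2) that by (intro member_le_sum) auto
  interpret recurrent m l V P I J A kap K0 C0
  proof unfold_locales
    show "P \<noteq> {}" using P(2) fin[of "{}"] by auto
    show "kap a \<le> K0" if "a \<in> A" for a unfolding K0_def using A(2) that by (intro member_le_sum) simp_all
    show "0 \<le> C0" unfolding C0_def by (intro sum_nonneg) auto
    show "\<bar>real (a u) - mu ^ kap a * real u\<bar> \<le> C0" if "a \<in> A" for a u
      using kC[OF that, of u] C0[OF that] by linarith
    show "inv_ideal J" "V \<notin> J" "I \<in> J" "finite A" "A \<subseteq> moves" "V \<subseteq> I \<union> (\<Union>a\<in>A. a -` P)"
      by (fact J V P A)+
    show "X \<in> J" if "finite X" for X using fin that .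
    show "{u\<in>P. mean x u \<notin> V} \<in> J" if "x \<in> P" for x using P(3) that by simp
  qed
  from fill_interval[OF T, of N] show ?thesis unfolding almost_all_def .
qed

section \<open>Sets that obey the law have bounded gaps\<close>

lemma mu_pow_small:
  assumes "0 < (e::real)" obtains j0 where "\<And>j. j0 \<le> j \<Longrightarrow> mu ^ j < e"
proof -
  obtain j0 where j0: "mu ^ j0 < e" using real_arch_pow_inv[OF assms, of mu] mu_bounds by auto
  have "mu ^ j < e" if "j0 \<le> j" for j
  proof -
    have "mu ^ j \<le> mu ^ j0" using mu_bounds that by (intro power_decreasing) auto
    then show ?thesis using j0 by linarith
  qed
  then show ?thesis using that by blast
qed

lemma mu_pow_between:
  assumes b: "0 < b" and u: "b < mu ^ j0 * real u"
  shows "\<exists>j\<ge>j0. mu * b < mu ^ j * u \<and> mu ^ j * u \<le> b"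
proof -
  have u0: "0 < real u" using b u by (metis gr0I less_trans mult_zero_right of_nat_0 of_nat_0_less_iff less_irrefl)
  obtain j1 where j1: "\<And>j. j1 \<le> j \<Longrightarrow> mu ^ j < b / u" using mu_pow_small[of "b / u"] b u0 by auto
  have ex: "mu ^ j1 * u \<le> b" using j1[of j1] u0 by (simp add: pos_less_divide_eq)
  define j where "j = (LEAST j. mu ^ j * u \<le> b)"
  have j: "mu ^ j * u \<le> b" unfolding j_def using ex by (rule LeastI)
  have "j0 < j"
  proof (rule ccontr)
    assume "\<not> j0 < j"
    then have "mu ^ j0 * u \<le> mu ^ j * u" using mu_bounds by (intro mult_right_mono power_decreasing) auto
    then show False using j u by linarith
  qed
  then obtain i where i: "j = Suc i" by (cases j) auto
  have "\<not> mu ^ i * u \<le> b" using not_less_Least[of i "\<lambda>j. mu ^ j * u \<le> b"] i unfolding j_def by auto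
  then have "mu * b < mu * (mu ^ i * u)" using mu_bounds by (intro mult_strict_left_mono) auto
  then show ?thesis using j i \<open>j0 < j\<close> by (intro exI[of _ j]) (auto simp: mult.assoc)
qed

text \<open>The sets that, on all sufficiently large scales \<open>mu ^ (- i)\<close>, avoid the neighbourhood of the edge
\<open>g\<close> that reaches a bounded distance \<open>c\<close> to the left and a fixed proportion \<open>e\<close> of the scale to the right.\<close>

definition edge_ideal :: "real \<Rightarrow> real \<Rightarrow> nat set set" where
  "edge_ideal g c = {W. \<exists>e>0. \<exists>j. \<forall>i\<ge>j. \<forall>u\<in>W. \<not> (g - c * mu ^ i \<le> mu ^ i * real u \<and> mu ^ i * real u \<le> g + e)}"

lemma edge_idealI:
  assumes "0 < e" "\<And>i u. j \<le> i \<Longrightarrow> u \<in> W \<Longrightarrow> g - c * mu ^ i \<le> mu ^ i * real u \<Longrightarrow> mu ^ i * real u \<le> g + e \<Longrightarrow> False"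
  shows "W \<in> edge_ideal g c"
  using assms unfolding edge_ideal_def by blast

lemma edge_idealE:
  assumes "W \<in> edge_ideal g c"
  obtains e j where "0 < e" "\<And>i u. j \<le> i \<Longrightarrow> u \<in> W \<Longrightarrow> g - c * mu ^ i \<le> mu ^ i * real u \<Longrightarrow> \<not> mu ^ i * real u \<le> g + e"
  using assms unfolding edge_ideal_def by blast

lemma edge_ideal_finite:
  assumes g: "0 < g" and c: "0 \<le> c" and W: "finite W"
  shows "W \<in> edge_ideal g c"
proof -
  obtain N where N: "\<forall>u\<in>W. u \<le> N" using W by (auto simp: finite_nat_set_iff_bounded_le)
  obtain j where j: "\<And>i. j \<le> i \<Longrightarrow> mu ^ i < g / (real N + c + 1)" using mu_pow_small[of "g / (real N + c + 1)"] g c by auto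
  show ?thesis
  proof (rule edge_idealI[of 1 j])
    fix i u assume H: "j \<le> i" "u \<in> W" "g - c * mu ^ i \<le> mu ^ i * real u"
    have "mu ^ i * (real N + c + 1) < g" using j[OF H(1)] c by (simp add: pos_less_divide_eq)
    then have "mu ^ i * real N + c * mu ^ i + mu ^ i < g" 
      by (simp add: distrib_left distrib_right mult.commute)
    moreover have "mu ^ i * real u \<le> mu ^ i * real N" using N H(2) mu_power(1)[of i] by (intro mult_left_mono) (auto simp: less_imp_le)
    ultimately show False using H(3) mu_power(1)[of i] by linarith
  qed simp
qed

text \<open>Rounding in \<open>eta\<close> costs at most \<open>1\<close>, while the allowance \<open>c\<close> on the left shrinks to \<open>mu * c\<close>; hence
the hypothesis on \<open>lam * c\<close>.\<close>

lemma edge_ideal_inv: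
  assumes g: "0 < g" and c: "0 \<le> c" "1 \<le> lam * c"
  shows "inv_ideal (edge_ideal g c)"
  unfolding inv_ideal_def
proof (intro conjI ballI allI impI)
  show "{} \<in> edge_ideal g c" using edge_ideal_finite[OF g c(1)] by simp
  fix W assume "W \<in> edge_ideal g c"
  then obtain e j where e: "0 < e" and W: "\<And>i u. j \<le> i \<Longrightarrow> u \<in> W \<Longrightarrow> g - c * mu ^ i \<le> mu ^ i * real u \<Longrightarrow> \<not> mu ^ i * real u \<le> g + e"
    by (rule edge_idealE) blast
  show "W' \<in> edge_ideal g c" if "W' \<subseteq> W" for W'
    using e W that by (intro edge_idealI[of e j]) blast+
  show "W \<union> W' \<in> edge_ideal g c" if "W' \<in> edge_ideal g c" for W'
  proof -
    from that obtain e' j' where e': "0 < e'" and W': "\<And>i u. j' \<le> i \<Longrightarrow> u \<in> W' \<Longrightarrow> g - c * mu ^ i \<le> mu ^ i * real u \<Longrightarrow> \<not> mu ^ i * real u \<le> g + e'"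
      by (rule edge_idealE) blast
    show ?thesis
    proof (rule edge_idealI[of "min e e'" "max j j'"])
      fix i u assume H: "max j j' \<le> i" "u \<in> W \<union> W'" "g - c * mu ^ i \<le> mu ^ i * real u" "mu ^ i * real u \<le> g + min e e'"
      then have "\<not> u \<in> W" using W[of i u] by auto
      moreover have "\<not> u \<in> W'" using W'[of i u] H by auto
      ultimately show False using H(2) by blast
    qed (use e e' in simp)
  qed
  show "Suc -` W \<in> edge_ideal g c"
  proof -
    obtain j1 where j1: "\<And>i. j1 \<le> i \<Longrightarrow> mu ^ i < e / 2" using mu_pow_small[of "e / 2"] e by auto
    show ?thesis
    proof (rule edge_idealI[of "e / 2" "max j j1"])
      fix i u assume H: "max j j1 \<le> i" "u \<in> Suc -` W" "g - c * mu ^ i \<le> mu ^ i * real u" "mu ^ i * real u \<le> g + e / 2"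
      have "mu ^ i * real (Suc u) = mu ^ i * u + mu ^ i" by (simp add: algebra_simps)
      then show False using W[of i "Suc u"] H j1[of i] mu_power(1)[of i] by auto
    qed (use e in simp)
  qed
  show "eta -` W \<in> edge_ideal g c"
  proof (rule edge_idealI[of e "Suc j"])
    fix i u assume H: "Suc j \<le> i" "u \<in> eta -` W" "g - c * mu ^ i \<le> mu ^ i * real u" "mu ^ i * real u \<le> g + e"
    then obtain i' where i': "i = Suc i'" "j \<le> i'" by (cases i) auto
    have p: "0 < mu ^ i'" by (rule mu_power)
    have "mu ^ i' * eta u \<le> mu ^ i' * (mu * u)" using eta_bounds p by (intro mult_left_mono) auto
    then have a: "mu ^ i' * eta u \<le> g + e" using H(4) i' by (simp add: mult_ac)
    have "mu ^ i' * (mu * u - 1) \<le> mu ^ i' * eta u" using eta_bounds p by (intro mult_left_mono) auto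
    moreover have "mu ^ i' * 1 \<le> mu ^ i' * (lam * c)" using c(2) p by (intro mult_left_mono) auto
    moreover have "mu ^ i' * (lam * c) = c * mu ^ i' - c * mu ^ i"
    proof -
      have "mu ^ i' * (lam * c) = (lam + mu) * (c * mu ^ i') - c * mu ^ i" unfolding i' by (simp add: algebra_simps)
      then show ?thesis using mu_bounds(5) by simp
    qed
    moreover have "mu ^ i' * (mu * u - 1) = mu ^ i * u - mu ^ i'" using i' by (simp add: algebra_simps)
    ultimately have "g - c * mu ^ i' \<le> mu ^ i' * eta u" using H(3) by linarith
    then show False using W[OF i'(2), of "eta u"] H(2) a by auto
  qed (rule e)
qed

lemma law_shift: "law P s \<Longrightarrow> law (\<lambda>u. P (u + t)) s"
  using law_affine[of P s 1 t] by simp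

text \<open>The variables below correspond to the informal argument as follows: \<open>[a, b]\<close> is the wedge that a long gap produces by descent,
\<open>G\<close> consists of the possible left ends of wedges, \<open>g\<close> is the left edge, \<open>D\<close> bounds the gaps to the right of the edge, and \<open>H\<close>
consists of the starting points of longer gaps.\<close>

theorem law_syndetic:
  assumes law: "law (\<lambda>u. u \<in> V) False" and inf: "infinite V"
  shows "\<exists>K::nat. \<forall>v. \<exists>u\<in>V. v \<le> u \<and> u \<le> v + K"
proof (rule ccontr)
  assume ns: "\<not> ?thesis"
  have mean_recurrent: "mean_recurrent V" using law_mean_recurrent law .
  from descent[OF mean_recurrent] obtain k :: real where k: "0 \<le> k"
    "\<And>j u. u \<in> V \<Longrightarrow> k \<le> mu ^ j * real u \<Longrightarrow> \<exists>u'\<in>V. mu ^ j * u \<le> u' \<and> u' \<le> mu ^ j * u + k" by metis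
  define K where "K = nat \<lceil>k\<rceil> + 3"
  have K: "k + 3 \<le> K" unfolding K_def by linarith
  obtain v0 where v0: "\<And>u. u \<in> V \<Longrightarrow> v0 \<le> u \<Longrightarrow> \<not> u \<le> v0 + 2 * K" using ns by blast
  define a where "a = real (v0 + K)"
  have a: "k + 3 \<le> a" using K by (simp add: a_def)
  define b where "b = a + 1"
  \<comment> \<open>No point of \<open>V\<close> can descend into \<open>[a, b]\<close>: the next descent would end in the gap.\<close>
  have wedge: "\<not> (a \<le> mu ^ j * u \<and> mu ^ j * u \<le> b)" if u: "u \<in> V" for u j
  proof
    assume H: "a \<le> mu ^ j * u \<and> mu ^ j * u \<le> b"
    then obtain w where "w \<in> V" "mu ^ j * u \<le> w" "w \<le> mu ^ j * u + k" using k(2)[OF u, of j] a by auto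
    then show False using v0[of w] H K unfolding b_def a_def by linarith
  qed
  define G where "G = {x. 0 < x \<and> x \<le> b \<and> (\<exists>j0. \<forall>j\<ge>j0. \<forall>u\<in>V. \<not> (x \<le> mu ^ j * real u \<and> mu ^ j * real u \<le> b))}"
  have b0: "0 < b" using a k by (simp add: b_def)
  have aG: "a \<in> G" using wedge a k b0 unfolding G_def by (auto simp: b_def)
  have G_lb: "mu * b \<le> x" if xG: "x \<in> G" for x
  proof (rule ccontr)
    assume x: "\<not> mu * b \<le> x"
    obtain j0 where j0: "\<And>j u. j0 \<le> j \<Longrightarrow> u \<in> V \<Longrightarrow> x \<le> mu ^ j * u \<Longrightarrow> \<not> mu ^ j * u \<le> b" 
      using xG unfolding G_def by blast
    obtain u where u: "u \<in> V" "nat \<lceil>b / mu ^ j0\<rceil> < u" using inf infinite_nat_iff_unbounded by blast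
    have "b / mu ^ j0 < u" using u(2) by linarith
    then have "b < mu ^ j0 * u" using mu_power(1)[of j0] by (simp add: pos_divide_less_eq mult.commute)
    from mu_pow_between[OF b0 this] obtain j where "j \<ge> j0" "mu * b < mu ^ j * u" "mu ^ j * u \<le> b" by blast
    then show False using j0[of j u] u(1) x by auto
  qed
  define g where "g = Inf G"
  have bdd: "bdd_below G" using G_lb by (rule bdd_belowI)
  have "mu * b \<le> g" unfolding g_def using aG G_lb by (intro cInf_greatest) auto
  then have g0: "0 < g" using b0 mu_bounds by (smt (verit) mult_pos_pos)
  have ga: "g \<le> a" unfolding g_def by (rule cInf_lower[OF aG bdd])
  have free: "\<exists>j0. \<forall>j\<ge>j0. \<forall>u\<in>V. \<not> (g + e \<le> mu ^ j * real u \<and> mu ^ j * real u \<le> b)" if e: "0 < e" for e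
  proof -
    have "\<exists>x\<in>G. x < g + e" unfolding g_def by (rule cInf_lessD) (use aG e in auto)
    then obtain x j0 where x: "x < g + e" and j0: "\<forall>j\<ge>j0. \<forall>u\<in>V. \<not> (x \<le> mu ^ j * real u \<and> mu ^ j * real u \<le> b)" 
      unfolding G_def by blast
    have "\<not> (g + e \<le> mu ^ j * real u \<and> mu ^ j * real u \<le> b)" if "j \<ge> j0" "u \<in> V" for j u
      using j0[rule_format, OF that] x by linarith
    then show ?thesis by blast
  qed
  define c where "c = k + 1 + 1 / lam"
  have c: "k + 1 \<le> c" "0 \<le> c" "1 \<le> lam * c" using mu_bounds k by (auto simp: c_def distrib_left)
  obtain i0 where i0: "\<And>i. i0 \<le> i \<Longrightarrow> mu ^ i < g / (k + c + 1)" using mu_pow_small[of "g / (k + c + 1)"] g0 k c by auto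
  \<comment> \<open>Otherwise, by descent, \<open>V\<close> would avoid a wedge with left end \<open>g - mu ^ i\<close>.\<close>
  have near: "\<exists>u\<in>V. g - c * mu ^ i \<le> mu ^ i * u \<and> mu ^ i * u \<le> g + c * mu ^ i" if i: "i0 \<le> i" for i
  proof (rule ccontr)
    assume no: "\<not> ?thesis"
    define d where "d = mu ^ i"
    have d: "0 < d" using mu_power by (simp add: d_def)
    have d2: "d * (k + c + 1) < g" using i0[OF i] k c by (simp add: d_def pos_less_divide_eq)
    then have d3: "d * k + d * c + d < g" by (simp add: distrib_left)
    have dk: "0 \<le> d * k" "0 \<le> d * c" "d * k + d \<le> d * c" 
      using d k c(2) mult_left_mono[OF c(1), of d] by (auto simp: distrib_left)
    have down: False if u: "u \<in> V" and H: "g - d \<le> mu ^ (i + j) * u" "mu ^ (i + j) * u \<le> g + d" for u j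
    proof -
      have e: "mu ^ (i + j) * u = d * (mu ^ j * u)" by (simp add: d_def power_add)
      have "d * k \<le> d * (mu ^ j * u)" using H(1) d3 dk unfolding e by linarith
      then have "k \<le> mu ^ j * u" using d by simp
      then obtain w where w: "w \<in> V" "mu ^ j * u \<le> w" "w \<le> mu ^ j * u + k" using k(2)[OF u] by blast
      have "d * (mu ^ j * u) \<le> d * w" "d * w \<le> d * (mu ^ j * u + k)" using w d by simp_all
      then have "d * (mu ^ j * u) \<le> d * w" "d * w \<le> d * (mu ^ j * u) + d * k" by (simp_all add: distrib_left)
      then have "g - c * d \<le> d * w" "d * w \<le> g + c * d" using H dk unfolding e by (simp_all add: mult.commute)
      then show False using no w(1) unfolding d_def by blast
    qed
    obtain j0 where j0: "\<forall>j\<ge>j0. \<forall>u\<in>V. \<not> (g + d \<le> mu ^ j * real u \<and> mu ^ j * real u \<le> b)" using free[OF d] by blast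
    have "\<forall>j\<ge>max i j0. \<forall>u\<in>V. \<not> (g - d \<le> mu ^ j * real u \<and> mu ^ j * real u \<le> b)"
    proof (intro allI ballI impI notI)
      fix j u assume H: "max i j0 \<le> j" "u \<in> V" "g - d \<le> mu ^ j * real u \<and> mu ^ j * real u \<le> b"
      show False
      proof (cases "mu ^ j * real u \<le> g + d")
        case True
        then show False using down[OF H(2), of "j - i"] H by auto
      next
        case False
        then show False using j0 H by auto
      qed
    qed
    moreover have "0 < g - d" "g - d \<le> b" using d3 dk ga d unfolding b_def by linarith+
    ultimately have "g - d \<in> G" unfolding G_def by blast
    then have "g \<le> g - d" unfolding g_def by (intro cInf_lower bdd)
    then show False using d by simp
  qed
  define J0 where "J0 = edge_ideal g c"
  have J0: "inv_ideal J0" unfolding J0_def using edge_ideal_inv g0 c(2,3) by blast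
  have "V \<notin> J0"
  proof
    assume "V \<in> J0"
    then obtain e j where e: "0 < e" and W: "\<And>i u. j \<le> i \<Longrightarrow> u \<in> V \<Longrightarrow> g - c * mu ^ i \<le> mu ^ i * real u \<Longrightarrow> \<not> mu ^ i * real u \<le> g + e"
      unfolding J0_def by (rule edge_idealE) blast
    obtain j1 where j1: "\<And>i. j1 \<le> i \<Longrightarrow> mu ^ i < e / (c + 1)" using mu_pow_small[of "e / (c + 1)"] e c by auto
    define i where "i = max (max j j1) i0"
    have i: "j \<le> i" "j1 \<le> i" "i0 \<le> i" by (auto simp: i_def)
    obtain u where u: "u \<in> V" "g - c * mu ^ i \<le> mu ^ i * u" "mu ^ i * u \<le> g + c * mu ^ i" using near[OF i(3)] by blast
    have "mu ^ i * (c + 1) < e" using j1[OF i(2)] c by (simp add: pos_less_divide_eq)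
    then have "c * mu ^ i \<le> e" using mu_power(1)[of i] by (simp add: algebra_simps)
    then show False using W[OF i(1) u(1,2)] u(3) by linarith
  qed
  then obtain J where J: "inv_ideal J" "J0 \<subseteq> J" "V \<notin> J"
    and Jm: "\<forall>J'. inv_ideal J' \<longrightarrow> J \<subseteq> J' \<longrightarrow> V \<notin> J' \<longrightarrow> J' = J"
    by (rule maximal_inv_ideal[OF J0])
  note Jmax = Jm[rule_format]
  have fin: "X \<in> J" if "finite X" for X
    using edge_ideal_finite[OF g0 c(2) that] J(2) unfolding J0_def by blast
  \<comment> \<open>The order of choices matters: \<open>D\<close> depends only on \<open>V\<close>, then \<open>H\<close> determines \<open>k'\<close>, and only now \<open>T\<close>, \<open>N\<close>, \<open>E\<close> and \<open>u\<close> are chosen.\<close>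
  define D where "D = nat \<lceil>k\<rceil> + 6"
  have D: "k + 6 \<le> D" unfolding D_def by linarith
  define H where "H = {v. \<forall>d\<in>{..D}. v + d \<notin> V}"
  have "law (\<lambda>v. v \<in> H) False"
    unfolding H_def mem_Collect_eq by (intro law_ball law_shift law_not law) simp
  from descent[OF law_mean_recurrent[OF this]] obtain k' :: real where k': "0 \<le> k'"
    "\<And>j u. u \<in> H \<Longrightarrow> k' \<le> mu ^ j * real u \<Longrightarrow> \<exists>u'\<in>H. mu ^ j * u \<le> u' \<and> u' \<le> mu ^ j * u + k'" by metis
  define T where "T = nat \<lceil>c + k + k'\<rceil> + 3"
  have T: "c + k + k' + 3 \<le> T" unfolding T_def by linarith
  then have T1: "1 \<le> T" using c k k' by linarith
  define N where "N = nat \<lceil>k'\<rceil> + 10"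
  have N: "k' + 10 \<le> N" unfolding N_def by linarith
  define fills where "fills E u \<longleftrightarrow> (\<forall>t\<in>{T..T + N}. \<exists>j\<le>E. \<exists>w\<in>V.
    \<bar>mu ^ (E - j) * real w - (mu ^ E * real u + real t)\<bar> \<le> 2)" for E u
  have "\<exists>E. {u\<in>V. \<not> fills E u} \<in> J"
    unfolding fills_def
  proof (rule fill_interval_maximal[OF mean_recurrent J(1) _ J(3) _ T1])
    show "X \<in> J" if "finite X" for X using fin[OF that] .
    show "J' = J" if "inv_ideal J'" "J \<subseteq> J'" "V \<notin> J'" for J' using Jmax[OF that] .
  qed
  then obtain E where E: "{u\<in>V. \<not> fills E u} \<in> J" ..
  define good where "good = fills E"
  have "{u\<in>V. \<not> good u} \<in> J" using E unfolding good_def .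
  moreover have "V = {u\<in>V. good u} \<union> {u\<in>V. \<not> good u}" by blast
  ultimately have "{u\<in>V. good u} \<notin> J" using J(3) inv_idealD(3)[OF J(1)] by metis
  then have gJ: "{u\<in>V. good u} \<notin> edge_ideal g c" using J(2) unfolding J0_def by blast
  define e where "e = (b - g) / 2"
  have e: "0 < e" using ga by (simp add: e_def b_def)
  obtain j1 where j1: "\<And>i. j1 \<le> i \<Longrightarrow> mu ^ i < e / (T + 4)" using mu_pow_small[of "e / (T + 4)"] e by auto
  obtain i u where i: "E + j1 \<le> i" and u: "u \<in> V" "good u" "g - c * mu ^ i \<le> mu ^ i * real u" "mu ^ i * real u \<le> g + e"
    using gJ edge_idealI[of e "E + j1" "{u\<in>V. good u}" g c] e by blast
  define y0 where "y0 = mu ^ E * u"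
  have y0: "0 \<le> y0" using mu_power(1)[of E] by (simp add: y0_def)
  \<comment> \<open>The interval from \<open>y0 + T\<close> to \<open>y0 + T + N\<close>, where all gaps are short.\<close>
  have dense: "v \<notin> H" if v: "y0 + T + 2 \<le> real v" "real v \<le> y0 + T + N - 3" for v
  proof -
    define t where "t = nat \<lceil>real v - y0\<rceil> + 2"
    have t: "real v + 2 \<le> y0 + t" "y0 + t \<le> real v + 3" using v unfolding t_def by linarith+
    have "T \<le> t" "t \<le> T + N" using t v by linarith+
    then have "t \<in> {T..T + N}" by simp
    then obtain j w where jw: "j \<le> E" "w \<in> V" "\<bar>mu ^ (E - j) * real w - (mu ^ E * real u + real t)\<bar> \<le> 2"
      using u(2) unfolding good_def fills_def by blast
    have w: "y0 + t - 2 \<le> mu ^ (E - j) * w" "mu ^ (E - j) * w \<le> y0 + t + 2" using jw(3) unfolding y0_def by linarith+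
    have "k \<le> mu ^ (E - j) * w" using w(1) t(1) v(1) y0 T c k' by linarith
    then obtain w' where w': "w' \<in> V" "mu ^ (E - j) * w \<le> w'" "w' \<le> mu ^ (E - j) * w + k" using k(2)[OF jw(2)] by blast
    have "real v \<le> w'" "real w' \<le> v + k + 5" using w w' t by linarith+
    then have r: "v \<le> w'" "w' - v \<le> D" using D by linarith+
    then have "v + (w' - v) \<in> V" using w' by simp
    then show "v \<notin> H" using r unfolding H_def by blast
  qed
  define y where "y = y0 + T + 2"
  \<comment> \<open>Hence starting points of long gaps never descend into \<open>[y, y + 1]\<close>.\<close>
  have noH: False if z: "z \<in> H" "y \<le> mu ^ j * z" "mu ^ j * z \<le> y + 1" for z j
  proof -
    have "k' \<le> mu ^ j * z" using z(2) T y0 c k unfolding y_def by linarith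
    then obtain z' where z': "z' \<in> H" "mu ^ j * z \<le> z'" "z' \<le> mu ^ j * z + k'" using k'(2)[OF z(1)] by blast
    have "z' \<notin> H" using z' z N by (intro dense) (auto simp: y_def)
    then show False using z'(1) by blast
  qed
  define i' where "i' = i - E"
  have ii: "i = E + i'" "j1 \<le> i'" using i by (auto simp: i'_def)
  define x where "x = mu ^ i'"
  have x: "0 < x" "x * (T + 4) < e" "mu ^ i \<le> x" 
    using mu_power j1[OF ii(2)] power_decreasing[of i' i mu] mu_bounds ii by (auto simp: x_def pos_less_divide_eq)
  have xy0: "x * y0 = mu ^ i * u" by (simp add: x_def y0_def ii power_add)
  have xy: "x * y = mu ^ i * u + x * T + 2 * x" unfolding y_def by (simp add: distrib_left xy0)
  have xT: "x * T + 4 * x < e" using x(2) by (simp add: distrib_left)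
  have "c * mu ^ i \<le> T * x" using x T c k k' mu_power(1)[of i] by (intro mult_mono) auto
  then have "0 < x * y - g" using u(3) x(1) unfolding xy by (simp add: mult.commute)
  from free[OF this] obtain j0 where j0: "\<And>j u. j0 \<le> j \<Longrightarrow> u \<in> V \<Longrightarrow> x * y \<le> mu ^ j * real u \<Longrightarrow> \<not> mu ^ j * real u \<le> b" by auto
  obtain j2 where j2: "\<And>j. j2 \<le> j \<Longrightarrow> mu ^ j < 1 / (D + 1)" using mu_pow_small[of "1 / (D + 1)"] by auto
  \<comment> \<open>Far up, the dilate of \<open>[y, y + 1]\<close> lies inside the wedge and starts a gap longer than \<open>D\<close>.\<close>
  define j where "j = max j0 j2"
  define p where "p = mu ^ j"
  have p: "0 < p" "p * (D + 1) < 1" using mu_power j2[of j] by (auto simp: p_def j_def pos_less_divide_eq)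
  have pD: "p * D + p < 1" using p(2) by (simp add: distrib_left)
  have pD0: "0 \<le> p * D" using p by simp
  define z where "z = nat \<lceil>y / p\<rceil>"
  have "0 \<le> y / p" using p y0 by (simp add: y_def)
  then have z: "y / p \<le> z" "z \<le> y / p + 1" unfolding z_def by linarith+
  have pz: "y \<le> p * z" "p * z \<le> y + p"
    using mult_left_mono[OF z(1), of p] mult_left_mono[OF z(2), of p] p(1) by (simp_all add: distrib_left)
  have "z \<in> H"
    unfolding H_def
  proof (intro CollectI ballI notI)
    fix d assume d: "d \<in> {..D}" and zd: "z + d \<in> V"
    have "p * real (z + d) = p * z + p * d" by (simp add: distrib_left)
    moreover have "p * d \<le> p * D" using d p(1) by (intro mult_left_mono) auto
    moreover have "0 \<le> p * d" using p(1) by simp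
    ultimately have "y \<le> p * real (z + d)" "p * real (z + d) \<le> y + 1" using pz pD by linarith+
    then have xz: "x * y \<le> x * (p * real (z + d))" "x * (p * real (z + d)) \<le> x * (y + 1)" 
      using x(1) by (auto intro!: mult_left_mono)
    have eq: "x * (p * real (z + d)) = mu ^ (i' + j) * real (z + d)" by (simp add: x_def p_def power_add)
    have "x * (y + 1) \<le> b"
    proof -
      have eq: "x * (y + 1) = mu ^ i * u + x * T + 3 * x" by (simp add: distrib_left xy)
      have "e = b - g - e" by (simp add: e_def field_simps)
      then show ?thesis unfolding eq using xT u(4) x(1) by linarith
    qed
    then have "mu ^ (i' + j) * real (z + d) \<le> b" using xz(2) unfolding eq by linarith
    moreover have "j0 \<le> i' + j" unfolding j_def by simp
    ultimately show False using j0[OF _ zd xz(1)[unfolded eq]] by blast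
  qed
  moreover have "y \<le> mu ^ j * z" "mu ^ j * z \<le> y + 1" using pz pD pD0 unfolding p_def by linarith+
  ultimately show False by (rule noH)
qed

section \<open>Colourings without a monochromatic configuration\<close>

lemma infinite_exceeds:
  assumes "infinite (S :: nat set)" obtains x where "x \<in> S" "N < x"
  using assms infinite_nat_iff_unbounded by blast

text \<open>Both truth values of a flipping \<open>P\<close> occur infinitely often: one on a thinned out subset, the other at
its means.\<close>

lemma flip_infinite:
  assumes X: "law (\<lambda>u. u \<in> X) False" "infinite X" and P: "law P True"
  shows "infinite {u\<in>X. P u = b}"
proof -
  from X(1) P X(2) obtain T b1 b2 where T: "T \<subseteq> X" "infinite T"
    "follows (\<lambda>u. u \<in> X) False b1 T" "follows P True b2 T" by (rule law2E)
  obtain x where x: "x \<in> T" using T(2) by (metis finite.emptyI equals0I)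
  have b1: "b1" using followsD(1)[OF T(3) x] T(1) x by blast
  show ?thesis
  proof (cases "b = b2")
    case True
    have "T \<subseteq> {u\<in>X. P u = b}" using T(1) followsD(1)[OF T(4)] True by auto
    then show ?thesis using T(2) infinite_super by blast
  next
    case False
    have "mean x ` {y\<in>T. x < y} \<subseteq> {u\<in>X. P u = b}"
      using followsD(3)[OF T(3) x] followsD(3)[OF T(4) x] b1 False by auto
    then show ?thesis using means_unbounded[OF T(2) x] infinite_super by blast
  qed
qed

lemma law_eq_const:
  assumes "law P False" shows "law (\<lambda>u. P u = e) False"
  using assms law_not[OF assms] by (cases e) simp_all

end

text \<open>A colouring for which the desired configuration does not exist in either colour.\<close>

locale avoiding = weights +
  fixes c :: "nat \<Rightarrow> bool"
  assumes avoids: "\<And>b B. infinite B \<Longrightarrow> 0 \<notin> B \<Longrightarrow> \<forall>x\<in>B. c (n * x) = b \<Longrightarrow>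
    \<forall>x\<in>B. \<forall>y\<in>B. x < y \<longrightarrow> c (m * x + l * y) = b \<Longrightarrow> False"
begin

definition g :: "nat \<Rightarrow> bool" where "g u = c (n * u)"

lemma law_g: "law g True"
proof (rule lawI)
  fix S :: "nat set" assume "infinite S"
  from infinite_residue[OF this] obtain S1 where S1: "S1 \<subseteq> S" "infinite S1"
    "\<forall>x\<in>S1. \<forall>y\<in>S1. n dvd m * x + l * y" by blast
  define f where "f X = (if c (m * Min X + l * Max X) then 1 else 0 :: nat)" for X
  have "infinite (S1 - {0})" using S1(2) by simp
  moreover have "\<forall>x\<in>S1 - {0}. \<forall>y\<in>S1 - {0}. x \<noteq> y \<longrightarrow> f {x, y} < 2" by (simp add: f_def)
  ultimately have "\<exists>Y t. Y \<subseteq> S1 - {0} \<and> infinite Y \<and> t < 2 \<and> (\<forall>x\<in>Y. \<forall>y\<in>Y. x \<noteq> y \<longrightarrow> f {x, y} = t)"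
    by (rule Ramsey2)
  then obtain Y t where Y: "Y \<subseteq> S1 - {0}" "infinite Y" and f: "\<And>x y. x \<in> Y \<Longrightarrow> y \<in> Y \<Longrightarrow> x \<noteq> y \<Longrightarrow> f {x, y} = t"
    by auto
  have ct: "c (m * x + l * y) = (t = 1)" if "x \<in> Y" "y \<in> Y" "x < y" for x y
    using f[of x y] that by (auto simp: f_def split: if_splits)
  have "\<exists>b\<in>UNIV. infinite {x\<in>Y. g x = b}"
    by (rule pigeonhole_infinite_rel) (use Y(2) in auto)
  then obtain b where b: "infinite {x\<in>Y. g x = b}" by (elim bexE)
  define T where "T = {x\<in>Y. g x = b}"
  have TY: "T \<subseteq> Y" "infinite T" "\<And>x. x \<in> T \<Longrightarrow> g x = b" using b by (auto simp: T_def)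
  have tb: "(t = 1) \<noteq> b"
  proof
    assume "(t = 1) = b"
    then have "\<forall>x\<in>T. \<forall>y\<in>T. x < y \<longrightarrow> c (m * x + l * y) = b" using TY(1) ct by auto
    moreover have "\<forall>x\<in>T. c (n * x) = b" using TY(3) by (simp add: g_def)
    moreover have "0 \<notin> T" using TY(1) Y(1) by auto
    ultimately show False by (intro avoids[OF TY(2)])
  qed
  have "follows g True b T"
  proof (rule followsI)
    fix x y assume xy: "x \<in> T" "y \<in> T" "x < y"
    show d: "n dvd m * x + l * y" using xy(1,2) TY(1) Y(1) S1(3) by blast
    have "n * mean x y = m * x + l * y" using d by (simp add: mean_def)
    moreover have "x \<in> Y" "y \<in> Y" using xy TY(1) by auto
    ultimately show "g (mean x y) = (b \<noteq> True)" using ct[of x y] xy(3) tb by (simp add: g_def)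
  qed (rule TY)
  then show "\<exists>T b. T \<subseteq> S \<and> infinite T \<and> follows g True b T" 
    using TY(1,2) Y(1) S1(1) by (intro exI[of _ T] exI[of _ b]) auto
qed

text \<open>Points that agree with the colour \<open>b\<close> at a dilate and at finitely many affine images. An element
\<open>n * u\<close> with \<open>u\<close> in \<open>Win b Ts\<close> can extend any configuration of colour \<open>b\<close> built from points \<open>n * x\<close> with \<open>m * x\<close> in \<open>Ts\<close>.\<close>

definition Win :: "bool \<Rightarrow> nat set \<Rightarrow> nat set" where
  "Win b Ts = {u. g (n * u) = b \<and> (\<forall>t\<in>Ts. g (l * u + t) = b)}"

text \<open>Each large \<open>x\<close> in \<open>Win b Ts\<close> forms a sum of colour \<open>b\<close> with only finitely many \<open>u\<close> in \<open>Win b Ts\<close>.\<close>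

definition closed_off :: "bool \<Rightarrow> nat set \<Rightarrow> bool" where
  "closed_off b Ts \<longleftrightarrow> (\<exists>M. \<forall>x\<in>Win b Ts. M < x \<longrightarrow> finite {u\<in>Win b Ts. g (m * x + l * u) = b})"

lemma Win_mono: "Ts \<subseteq> Ts' \<Longrightarrow> Win b Ts' \<subseteq> Win b Ts"
  by (auto simp: Win_def)

lemma closed_off_mono:
  assumes "closed_off b Ts" "Ts \<subseteq> Ts'" shows "closed_off b Ts'"
proof -
  obtain M where M: "\<forall>x\<in>Win b Ts. M < x \<longrightarrow> finite {u\<in>Win b Ts. g (m * x + l * u) = b}"
    using assms(1) unfolding closed_off_def by (elim exE)
  have "finite {u\<in>Win b Ts'. g (m * x + l * u) = b}" if "x \<in> Win b Ts'" "M < x" for x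
  proof (rule finite_subset)
    show "{u\<in>Win b Ts'. g (m * x + l * u) = b} \<subseteq> {u\<in>Win b Ts. g (m * x + l * u) = b}"
      using Win_mono[OF assms(2), of b] by auto
    show "finite {u\<in>Win b Ts. g (m * x + l * u) = b}" using M that Win_mono[OF assms(2), of b] by auto
  qed
  then show ?thesis unfolding closed_off_def by (intro exI[of _ M]) simp
qed

text \<open>Otherwise points could be added to a configuration of colour \<open>b\<close> for ever.\<close>

lemma closing_off:
  assumes Ts0: "finite Ts0" "infinite (Win b Ts0)"
  obtains Ts where "finite Ts" "Ts0 \<subseteq> Ts" "infinite (Win b Ts)" "closed_off b Ts"
proof (rule ccontr)
  assume "\<not> thesis"
  note nt = this that
  define ok where "ok Ts \<longleftrightarrow> finite Ts \<and> Ts0 \<subseteq> Ts \<and> infinite (Win b Ts)" for Ts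
  have step: "\<exists>x. x \<in> Win b Ts \<and> M < x \<and> ok (insert (m * x) Ts)" if ok: "ok Ts" for Ts M
  proof -
    have "\<not> closed_off b Ts" using nt ok unfolding ok_def by blast
    then obtain x where x: "x \<in> Win b Ts" "M < x" "infinite {u\<in>Win b Ts. g (m * x + l * u) = b}"
      unfolding closed_off_def by blast
    have "{u\<in>Win b Ts. g (m * x + l * u) = b} = Win b (insert (m * x) Ts)"
      unfolding Win_def by (auto simp: add.commute)
    then show ?thesis using x ok unfolding ok_def by auto
  qed
  define Q where "Q s s' \<longleftrightarrow> snd s' \<in> Win b (fst s) \<and> snd s < snd s' \<and> fst s' = insert (m * snd s') (fst s)"
    for s s' :: "nat set \<times> nat"
  have "\<exists>f. \<forall>k. ok (fst (f k)) \<and> Q (f k) (f (Suc k))"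
  proof (rule dependent_nat_choice[where P = "\<lambda>k s. ok (fst s)" and Q = "\<lambda>k. Q"])
    show "\<exists>s :: nat set \<times> nat. ok (fst s)" using Ts0 by (intro exI[of _ "(Ts0, 0)"]) (simp add: ok_def)
    fix s :: "nat set \<times> nat" assume "ok (fst s)"
    from step[OF this, of "snd s"] obtain x where "x \<in> Win b (fst s)" "snd s < x" "ok (insert (m * x) (fst s))" by blast
    then show "\<exists>s'. ok (fst s') \<and> Q s s'" by (intro exI[of _ "(insert (m * x) (fst s), x)"]) (simp add: Q_def)
  qed
  then obtain f where f: "\<And>k. Q (f k) (f (Suc k))" by blast
  define xs where "xs k = snd (f (Suc k))" for k
  define Tk where "Tk k = fst (f k)" for k
  have xs: "xs k \<in> Win b (Tk k)" "Tk (Suc k) = insert (m * xs k) (Tk k)" "0 < xs k" "xs k < xs (Suc k)" for k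
    using f[of k] f[of "Suc k"] by (auto simp: Q_def xs_def Tk_def)
  have sm: "strict_mono xs" using xs(4) by (simp add: strict_mono_Suc_iff)
  have Tm: "Tk i \<subseteq> Tk j" if "i \<le> j" for i j
    by (rule lift_Suc_mono_le[OF _ that]) (use xs(2) in auto)
  have pair: "g (m * xs i + l * xs j) = b" if "i < j" for i j
  proof -
    have "m * xs i \<in> Tk j" using Tm[of "Suc i" j] xs(2)[of i] that by auto
    then have "g (l * xs j + m * xs i) = b" using xs(1)[of j] by (simp add: Win_def)
    then show ?thesis by (simp only: add.commute)
  qed
  have "strict_mono (\<lambda>k. n * xs k)" using sm n_pos by (simp add: strict_mono_def)
  then have inf: "infinite (range (\<lambda>k. n * xs k))" using range_inj_infinite strict_mono_imp_inj_on by blast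
  show False
  proof (rule avoids[OF inf])
    show "0 \<notin> range (\<lambda>k. n * xs k)" using xs(3) n_pos by (auto simp: image_iff)
    show "\<forall>x\<in>range (\<lambda>k. n * xs k). c (n * x) = b" using xs(1) by (auto simp: Win_def g_def)
    show "\<forall>x\<in>range (\<lambda>k. n * xs k). \<forall>y\<in>range (\<lambda>k. n * xs k). x < y \<longrightarrow> c (m * x + l * y) = b"
    proof (intro ballI impI)
      fix x y assume "x \<in> range (\<lambda>k. n * xs k)" "y \<in> range (\<lambda>k. n * xs k)" "x < y"
      then obtain i j where ij: "x = n * xs i" "y = n * xs j" "xs i < xs j" using n_pos by auto
      have "i < j" using ij(3) sm strict_mono_less by blast
      moreover have "m * x + l * y = n * (m * xs i + l * xs j)" unfolding ij by (simp add: algebra_simps)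
      ultimately show "c (m * x + l * y) = b" using pair[of i j] by (simp add: g_def)
    qed
  qed
qed

text \<open>The union of the two sets \<open>Win b Ts\<close>; it obeys the law without flip.\<close>

definition Coherent :: "nat set \<Rightarrow> nat set" where
  "Coherent Ts = {u. \<forall>t\<in>Ts. g (l * u + t) = g (n * u)}"

lemma Win_eq_Coherent: "Win b Ts = {u\<in>Coherent Ts. g (n * u) = b}"
  by (auto simp: Win_def Coherent_def)

lemma law_g_affine: "0 < r \<Longrightarrow> law (\<lambda>u. g (r * u + t)) True"
  by (rule law_affine[OF law_g])

lemma law_gn: "law (\<lambda>u. g (n * u)) True"
  using law_g_affine[OF n_pos, of 0] by simp

lemma law_Coherent: 
  assumes "finite Ts" shows "law (\<lambda>u. u \<in> Coherent Ts) False"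
  unfolding Coherent_def mem_Collect_eq
proof (rule law_ball[OF assms])
  fix t
  show "law (\<lambda>u. g (l * u + t) = g (n * u)) False"
    using law_eq[OF law_g_affine[OF l_pos, of t] law_gn] by simp
qed

lemma infinite_Win: "finite Ts \<Longrightarrow> infinite (Coherent Ts) \<Longrightarrow> infinite (Win b Ts)"
  unfolding Win_eq_Coherent by (rule flip_infinite[OF law_Coherent _ law_gn])

text \<open>Bounded gaps give each \<open>a\<close> bounded \<open>t\<close> and \<open>t'\<close> for which \<open>m * a + t\<close> and \<open>l * a + t'\<close> are in
\<open>Coherent Ts\<close>; the bit \<open>e\<close> says whether both belong to the same \<open>Win b Ts\<close>. For some pattern \<open>(t, t', e)\<close> the set
\<open>A\<close> of these \<open>a\<close> is infinite, and it obeys the law, so that it has bounded gaps too. Hence, for a fixed \<open>v\<close>, infinitely many pairs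
\<open>a\<close>, \<open>a + v\<close> in \<open>A\<close> differ in the colour \<open>sg\<close> that belongs to \<open>m * a + t\<close>, and by the law for such pairs the change occurs
infinitely often in each direction.\<close>

lemma avoiding_False: False
proof -
  have "Coherent {} = UNIV" by (simp add: Coherent_def)
  then have "infinite (Win False {})" by (intro infinite_Win) simp_all
  then obtain Ts1 where Ts1: "finite Ts1" "infinite (Win False Ts1)" "closed_off False Ts1"
    by (rule closing_off[OF finite.emptyI])
  have Coherent_infinite: "infinite (Coherent Ts)" if "infinite (Win b Ts)" for b Ts
    using that infinite_super[of "Win b Ts" "Coherent Ts"] by (auto simp: Win_eq_Coherent)
  have "infinite (Win True Ts1)" using infinite_Win[OF Ts1(1) Coherent_infinite[OF Ts1(2)]] .
  then obtain Ts where Ts: "finite Ts" "Ts1 \<subseteq> Ts" "infinite (Win True Ts)" "closed_off True Ts"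
    by (rule closing_off[OF Ts1(1)])
  have "closed_off False Ts" using closed_off_mono Ts1(3) Ts(2) .
  then obtain M0 where M0: "\<forall>x\<in>Win False Ts. M0 < x \<longrightarrow> finite {u\<in>Win False Ts. g (m * x + l * u) = False}"
    unfolding closed_off_def by (elim exE)
  obtain M1 where M1: "\<forall>x\<in>Win True Ts. M1 < x \<longrightarrow> finite {u\<in>Win True Ts. g (m * x + l * u) = True}"
    using Ts(4) unfolding closed_off_def by (elim exE)
  define Q where "Q = Coherent Ts"
  have lawQ: "law (\<lambda>u. u \<in> Q) False" unfolding Q_def by (rule law_Coherent[OF Ts(1)])
  obtain K :: nat where K: "\<forall>v. \<exists>u\<in>Q. v \<le> u \<and> u \<le> v + K"
    using law_syndetic[OF lawQ] Coherent_infinite[OF Ts(3)] unfolding Q_def by blast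
  have shift: "\<exists>t\<le>K. v + t \<in> Q" for v
  proof -
    obtain u where "u \<in> Q" "v \<le> u" "u \<le> v + K" using K by blast
    then show ?thesis by (intro exI[of _ "u - v"]) auto
  qed
  define R where "R = (\<lambda>(t, t', e). {a. m * a + t \<in> Q \<and> l * a + t' \<in> Q \<and>
      (g (n * (l * a + t')) = g (n * (m * a + t))) = e})"
  have "\<exists>k\<in>{..K} \<times> {..K} \<times> UNIV. infinite {a\<in>UNIV. a \<in> R k}"
  proof (rule pigeonhole_infinite_rel)
    show "\<forall>a\<in>UNIV. \<exists>k\<in>{..K} \<times> {..K} \<times> UNIV. a \<in> R k"
    proof
      fix a
      obtain t t' where "t \<le> K" "m * a + t \<in> Q" "t' \<le> K" "l * a + t' \<in> Q" using shift by blast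
      then show "\<exists>k\<in>{..K} \<times> {..K} \<times> UNIV. a \<in> R k"
        by (intro bexI[of _ "(t, t', g (n * (l * a + t')) = g (n * (m * a + t)))"]) (auto simp: R_def)
    qed
  qed simp_all
  then obtain t t' e where infR: "infinite (R (t, t', e))" by auto
  define A where "A = R (t, t', e)"
  define sg where "sg a = g (n * (m * a + t))" for a
  have A: "a \<in> A \<longleftrightarrow> m * a + t \<in> Q \<and> l * a + t' \<in> Q \<and> (g (n * (l * a + t')) = sg a) = e" for a
    by (simp add: A_def R_def sg_def)
  have lawsg: "law sg True" unfolding sg_def using law_affine[OF law_gn m_pos] .
  have lawA: "law (\<lambda>a. a \<in> A) False"
    unfolding A
  proof (intro law_conj law_eq_const)
    show "law (\<lambda>a. m * a + t \<in> Q) False" using law_affine[OF lawQ m_pos] .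
    show "law (\<lambda>a. l * a + t' \<in> Q) False" using law_affine[OF lawQ l_pos] .
    show "law (\<lambda>a. g (n * (l * a + t')) = sg a) False"
      using law_eq[OF law_affine[OF law_gn l_pos] lawsg] by simp
  qed
  have infA: "infinite A" using infR by (simp add: A_def)
  obtain K2 :: nat where K2: "\<forall>v. \<exists>u\<in>A. v \<le> u \<and> u \<le> v + K2" using law_syndetic[OF lawA infA] by blast
  define X where "X v = {a. (a \<in> A \<and> a + v \<in> A) \<and> (sg a = sg (a + v)) = False}" for v
  have "\<exists>v. infinite (X v)"
  proof (rule ccontr)
    assume "\<not> ?thesis"
    then have "finite (\<Union>v\<in>{..K2 + 1}. X v)" by simp
    then obtain N where N: "\<forall>a\<in>(\<Union>v\<in>{..K2 + 1}. X v). a \<le> N" 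
      by (auto simp: finite_nat_set_iff_bounded_le)
    have same: "sg a = sg (a + v)" if "N < a" "v \<le> K2 + 1" "a \<in> A" "a + v \<in> A" for a v
      using N that unfolding X_def by force
    obtain a0 where a0: "a0 \<in> A" "N < a0" using infA infinite_nat_iff_unbounded by blast
    have const: "u \<in> A \<Longrightarrow> a0 \<le> u \<Longrightarrow> sg u = sg a0" for u
    proof (induction u rule: less_induct)
      case (less u)
      show ?case
      proof (cases "u \<le> a0 + (K2 + 1)")
        case True
        then show ?thesis using same[of a0 "u - a0"] a0 less.prems by simp
      next
        case False
        obtain w where w: "w \<in> A" "u - 1 - K2 \<le> w" "w \<le> u - 1 - K2 + K2" using K2 by blast
        then have "w < u" "a0 \<le> w" "u - w \<le> K2 + 1" using False by auto
        then show ?thesis using less.IH[of w] same[of w "u - w"] w(1) a0 less.prems by simp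
      qed
    qed
    have "infinite {u\<in>A. sg u = (\<not> sg a0)}" by (rule flip_infinite[OF lawA infA lawsg])
    then obtain u where "u \<in> {u\<in>A. sg u = (\<not> sg a0)}" "a0 < u" by (rule infinite_exceeds)
    then show False using const[of u] by simp
  qed
  then obtain v where v: "infinite (X v)" by blast
  have lawX: "law (\<lambda>a. a \<in> X v) False"
    unfolding X_def mem_Collect_eq
  proof (intro law_conj law_eq_const lawA law_shift)
    show "law (\<lambda>a. sg a = sg (a + v)) False" using law_eq[OF lawsg law_shift[OF lawsg]] by simp
  qed
  have Xinf: "infinite {a\<in>X v. sg a = d}" for d by (rule flip_infinite[OF lawX v lawsg])
  obtain b where "b \<in> {a\<in>X v. sg a = e}" "max M0 M1 < b" by (rule infinite_exceeds[OF Xinf])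
  then have b: "b \<in> X v" "sg b = e" "max M0 M1 < b" by simp_all
  have lb: "b \<le> l * b" "b + v \<le> l * (b + v)" using l_pos by simp_all
  have bA: "b \<in> A" "b + v \<in> A" "sg (b + v) = (\<not> e)" using b(1,2) by (auto simp: X_def)
  define y0 where "y0 = l * (b + v) + t'"
  define y1 where "y1 = l * b + t'"
  have y0: "y0 \<in> Win False Ts" and y1: "y1 \<in> Win True Ts" 
    using bA b(2) unfolding y0_def y1_def Win_eq_Coherent A Q_def by auto
  have "M0 < y0" "M1 < y1" using lb b(3) unfolding y0_def y1_def by linarith+
  then have "finite ({u\<in>Win False Ts. g (m * y0 + l * u) = False} \<union> {u\<in>Win True Ts. g (m * y1 + l * u) = True})"
    using M0 M1 y0 y1 by simp
  then obtain N where N: "\<forall>u\<in>{u\<in>Win False Ts. g (m * y0 + l * u) = False} \<union> {u\<in>Win True Ts. g (m * y1 + l * u) = True}. u \<le> N"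
    unfolding finite_nat_set_iff_bounded_le by (elim exE)
  have N0: "g (m * y0 + l * u)" if "u \<in> Win False Ts" "N < u" for u using N that by force
  have N1: "\<not> g (m * y1 + l * u)" if "u \<in> Win True Ts" "N < u" for u using N that by force
  obtain a where "a \<in> {a\<in>X v. sg a = False}" "N < a" by (rule infinite_exceeds[OF Xinf])
  then have a: "a \<in> X v" "sg a = False" "N < a" by simp_all
  have aA: "a \<in> A" "a + v \<in> A" "sg (a + v)" using a by (auto simp: X_def)
  have ma: "a \<le> m * a" "a + v \<le> m * (a + v)" using m_pos by simp_all
  have "m * a + t \<in> Win False Ts" using aA(1) a(2) unfolding Win_eq_Coherent A Q_def sg_def by simp
  moreover have "N < m * a + t" using ma a(3) by linarith
  ultimately have e0: "g (m * y0 + l * (m * a + t))" by (rule N0)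
  have "m * (a + v) + t \<in> Win True Ts" using aA(2,3) unfolding Win_eq_Coherent A Q_def sg_def by simp
  moreover have "N < m * (a + v) + t" using ma a(3) by linarith
  ultimately have e1: "\<not> g (m * y1 + l * (m * (a + v) + t))" by (rule N1)
  have "m * y0 + l * (m * a + t) = m * y1 + l * (m * (a + v) + t)"
    by (simp add: y0_def y1_def algebra_simps)
  then show False using e0 e1 by simp
qed

end

section \<open>Monochromatic weighted sums\<close>

theorem monochromatic_weighted_sums:
  fixes c :: "nat \<Rightarrow> bool"
  assumes "0 < m" "0 < l"
  obtains b B where "infinite B" "0 \<notin> B" "\<forall>x\<in>B. c ((m + l) * x) = b"
    "\<forall>x\<in>B. \<forall>y\<in>B. x < y \<longrightarrow> c (m * x + l * y) = b"
proof (rule ccontr)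
  assume "\<not> thesis"
  note nt = this that
  interpret weights m l by unfold_locales (rule assms)+
  interpret avoiding m l c
  proof unfold_locales
    fix b B assume "infinite B" "0 \<notin> B" "\<forall>x\<in>B. c (n * x) = b"
      "\<forall>x\<in>B. \<forall>y\<in>B. x < y \<longrightarrow> c (m * x + l * y) = b"
    from nt(2)[OF this[unfolded n_def]] nt(1) show False by simp
  qed
  show False by (rule avoiding_False)
qed

theorem theorem1p6:
  fixes m l :: nat and C :: "nat \<Rightarrow> nat set"
  assumes "m \<in> pos_nats" and "l \<in> pos_nats"
    and "pos_nats = C 1 \<union> C 2" and "C 1 \<inter> C 2 = {}"
  shows "\<exists>i\<in>{1, 2}. \<exists>B. B \<subseteq> pos_nats \<and> infinite B \<and>
           dilate (m + l) B \<union> {m * x + l * y | x y. x \<in> B \<and> y \<in> B \<and> x < y} \<subseteq> C i"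
proof -
  have ml: "0 < m" "0 < l" using assms(1,2) by (auto simp: pos_nats_def)
  obtain b B where B: "infinite B" "0 \<notin> B" "\<forall>x\<in>B. ((m + l) * x \<in> C 1) = b"
    "\<forall>x\<in>B. \<forall>y\<in>B. x < y \<longrightarrow> (m * x + l * y \<in> C 1) = b"
    by (rule monochromatic_weighted_sums[OF ml, of "\<lambda>x. x \<in> C 1"])
  have pos: "0 < x" if "x \<in> B" for x using B(2) that by (metis gr0I)
  define i :: nat where "i = (if b then 1 else 2)"
  have mem: "z \<in> C i" if "0 < z" "(z \<in> C 1) = b" for z
  proof -
    have "z \<in> C 1 \<union> C 2" using that(1) unfolding assms(3)[symmetric] by (simp add: pos_nats_def)
    then show ?thesis using that(2) by (cases b) (auto simp: i_def)
  qed
  have "(m + l) * x \<in> C i" if "x \<in> B" for x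
    by (rule mem) (use B(3) pos[OF that] ml that in auto)
  moreover have "m * x + l * y \<in> C i" if "x \<in> B" "y \<in> B" "x < y" for x y
    by (rule mem) (use B(4) pos[OF that(1)] ml that in auto)
  ultimately have "dilate (m + l) B \<union> {m * x + l * y | x y. x \<in> B \<and> y \<in> B \<and> x < y} \<subseteq> C i"
    unfolding dilate_def by blast
  moreover have "B \<subseteq> pos_nats" using pos by (auto simp: pos_nats_def Suc_le_eq)
  moreover have "i \<in> {1, 2}" by (simp add: i_def)
  ultimately show ?thesis using B(1) by blast
qed

end
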